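(* Let $\mathcal C_k\subseteq\mathcal O(\mathbb{R}^2)$ be the group of $k$-fold rotations about the origin in the plane, let $(G=(V,E),\psi)$ be a finite $\mathcal C_k$-gain graph, and let $p:V\to\mathbb{R}^2$ be $\mathcal C_k$-generic. Then $$\dim_{\mathbb{R}}\operatorname{span}\{R_{e,\psi}(p)\mid e\in E\}=\hat h_\rho(E),$$ where $h_\rho(F)=2|V(F)|-2c(F)+\sum_{X\in C(F)}\dim_{\mathbb{R}}\operatorname{span}\{\operatorname{image}(I_2-\gamma)\mid\gamma\in\langle X\rangle\}-1$ for $F\subseteq E$.
   Context: $\mathbb{Q}_{\mathcal C_k}$ is the field generated by $\mathbb{Q}$ and the matrix entries of elements of $\mathcal C_k$; $p$ is $\mathcal C_k$-generic if all coordinates of all $p(v)$ are algebraically independent over $\mathbb{Q}_{\mathcal C_k}$. A $\mathcal C_k$-gain graph: $G$ finite directed graph (loops, parallel edges allowed), $\psi:E\to\mathcal C_k$, reversing an edge inverts its gain; walk gains are ordered products with inverses for backward edges. For connected $X$, $\langle X\rangle$ is the subgroup of gains of closed walks at a vertex of $V(X)$ using only edges of $X$. $V(F)$ = endvertices of $F$; $C(F)$ = edge sets of connected components of $(V(F),F)$; $c(F)=|C(F)|$. For a non-loop edge $e$ from $i$ to $j$ with gain $\psi_e$: $R_{e,\psi}(p)=\{x\in(\mathbb{R}^2)^V:\exists t\in\mathbb{R},\ x(i)=t(p(i)-\psi_ep(j)),\ x(j)=t(p(j)-\psi_e^{-1}p(i)),\ x(w)=0\ \forall w\ne i,j\}$.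 For a loop $e$ at $i$: $R_{e,\psi}(p)=\{x:\exists t\in\mathbb{R},\ x(i)=t(2I_2-\psi_e-\psi_e^{-1})p(i),\ x(w)=0\ \forall w\ne i\}$. Dilworth truncation: for $h:2^E\to\mathbb{Z}$, $F_+=\{e\in F:h(\{e\})\ge0\}$ and $\hat h(F)=\min\sum_i h(F_i)$ over partitions $\{F_1,\dots,F_k\}$ of $F_+$ into nonempty sets ($\hat h(F)=0$ if $F_+=\emptyset$). *)

theory Defs
  imports
    "HOL-Analysis.Analysis"
    "HOL-Library.Poly_Mapping"
    "HOL-Library.Disjoint_Sets"
    "Graph_Theory.Digraph_Component"
begin

section \<open>Rotation groups and generic points\<close>

definition rotation2 :: "real \<Rightarrow> real^2^2" where
  "rotation2 t = vector [vector [cos t, - sin t], vector [sin t, cos t]]"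

definition rotation_group :: "nat \<Rightarrow> (real^2^2) set" where
  "rotation_group k = {rotation2 (2 * pi * real j / real k) | j. j < k}"

definition is_subfield :: "'a::field set \<Rightarrow> bool" where
  "is_subfield K \<longleftrightarrow> 0 \<in> K \<and> 1 \<in> K \<and>
     (\<forall>x\<in>K. \<forall>y\<in>K. x + y \<in> K \<and> x * y \<in> K) \<and> (\<forall>x\<in>K. - x \<in> K \<and> inverse x \<in> K)"

definition generated_subfield :: "'a::field set \<Rightarrow> 'a set" where
  "generated_subfield S = \<Inter>{K. is_subfield K \<and> S \<subseteq> K}"

definition coefficient_field :: "(real^2^2) set \<Rightarrow> real set" where
  "coefficient_field \<Gamma> = generated_subfield (\<rat> \<union> {A $ r $ c | A r c. A \<in> \<Gamma>})"

text \<open>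
  A polynomial in variables indexed by \<^typ>\<open>'i\<close> is a finitely supported map from monomials to
  coefficients, and a monomial is a finitely supported exponent map.
\<close>

definition poly_value :: "(('i \<Rightarrow>\<^sub>0 nat) \<Rightarrow>\<^sub>0 'a::comm_ring_1) \<Rightarrow> ('i \<Rightarrow> 'a) \<Rightarrow> 'a" where
  "poly_value P x =
     (\<Sum>m\<in>Poly_Mapping.keys P. Poly_Mapping.lookup P m *
        (\<Prod>i\<in>Poly_Mapping.keys m. x i ^ Poly_Mapping.lookup m i))"

definition algebraically_independent_over ::
    "'a::field set \<Rightarrow> 'i set \<Rightarrow> ('i \<Rightarrow> 'a) \<Rightarrow> bool" where
  "algebraically_independent_over K I x \<longleftrightarrow>
     (\<forall>P :: ('i \<Rightarrow>\<^sub>0 nat) \<Rightarrow>\<^sub>0 'a.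
        (\<forall>m. Poly_Mapping.lookup P m \<in> K) \<longrightarrow>
        (\<forall>m\<in>Poly_Mapping.keys P. Poly_Mapping.keys m \<subseteq> I) \<longrightarrow>
        poly_value P x = 0 \<longrightarrow> P = 0)"

definition generic_on :: "(real^2^2) set \<Rightarrow> 'v set \<Rightarrow> ('v \<Rightarrow> real^2) \<Rightarrow> bool" where
  "generic_on \<Gamma> V p \<longleftrightarrow>
     algebraically_independent_over (coefficient_field \<Gamma>) (V \<times> (UNIV :: 2 set)) (\<lambda>(v, c). p v $ c)"

section \<open>Gain graphs\<close>

definition gain_graph :: "(real^2^2) set \<Rightarrow> ('v, 'e) pre_digraph \<Rightarrow> ('e \<Rightarrow> real^2^2) \<Rightarrow> bool" where
  "gain_graph \<Gamma> G \<psi> \<longleftrightarrow> fin_digraph G \<and> (\<forall>e\<in>arcs G. \<psi> e \<in> \<Gamma>)"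

definition endverts :: "('v, 'e) pre_digraph \<Rightarrow> 'e set \<Rightarrow> 'v set" where
  "endverts G F = tail G ` F \<union> head G ` F"

text \<open>
  The graph $(V(F), F)$ with each edge replaced by two arcs: \<open>(e, True)\<close> traverses \<open>e\<close> forward and
  \<open>(e, False)\<close> traverses it backward. Directed walks here are the walks of $(V(F), F)$ that
  disregard edge directions, and strong components here are its connected components.
\<close>

definition bidirected :: "('v, 'e) pre_digraph \<Rightarrow> 'e set \<Rightarrow> ('v, 'e \<times> bool) pre_digraph" where
  "bidirected G F =
     \<lparr> verts = endverts G F, arcs = F \<times> UNIV,
       tail = (\<lambda>(e, b). if b then tail G e else head G e),
       head = (\<lambda>(e, b). if b then head G e else tail G e) \<rparr>"

definition components :: "('v, 'e) pre_digraph \<Rightarrow> 'e set \<Rightarrow> 'e set set" where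
  "components G F =
     (\<lambda>U. {e \<in> F. tail G e \<in> U}) ` pre_digraph.sccs_verts (bidirected G F)"

fun step_gain :: "('e \<Rightarrow> real^2^2) \<Rightarrow> 'e \<times> bool \<Rightarrow> real^2^2" where
  "step_gain \<psi> (e, b) = (if b then \<psi> e else matrix_inv (\<psi> e))"

definition walk_gain :: "('e \<Rightarrow> real^2^2) \<Rightarrow> ('e \<times> bool) list \<Rightarrow> real^2^2" where
  "walk_gain \<psi> w = foldr (\<lambda>a A. step_gain \<psi> a ** A) w (mat 1)"

definition gain_subgroup ::
    "('v, 'e) pre_digraph \<Rightarrow> ('e \<Rightarrow> real^2^2) \<Rightarrow> 'e set \<Rightarrow> 'v \<Rightarrow> (real^2^2) set" where
  "gain_subgroup G \<psi> X v = {walk_gain \<psi> w | w. pre_digraph.awalk (bidirected G X) v w v}"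

text \<open>
  For connected \<open>X\<close>, another base vertex conjugates the gain subgroup, so it does not change at all
  when the gains commute, as rotations of the plane do. An arbitrary base vertex is chosen.
\<close>

definition gain_subgroup_of ::
    "('v, 'e) pre_digraph \<Rightarrow> ('e \<Rightarrow> real^2^2) \<Rightarrow> 'e set \<Rightarrow> (real^2^2) set" where
  "gain_subgroup_of G \<psi> X = gain_subgroup G \<psi> X (SOME v. v \<in> endverts G X)"

definition h_rho :: "('v, 'e) pre_digraph \<Rightarrow> ('e \<Rightarrow> real^2^2) \<Rightarrow> 'e set \<Rightarrow> int" where
  "h_rho G \<psi> F =
     2 * int (card (endverts G F)) - 2 * int (card (components G F))
     + (\<Sum>X\<in>components G F.
          int (dim (span (\<Union>\<gamma>\<in>gain_subgroup_of G \<psi> X. range (\<lambda>x. (mat 1 - \<gamma>) *v x)))))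
     - 1"

text \<open>
  The vertex set may be a proper subset of the finite type \<^typ>\<open>'v\<close>. Elements of the spaces below
  vanish off the ends of \<open>e\<close>, so for \<open>e \<in> arcs G\<close> they lie in the copy of $(\mathbb{R}^2)^V$
  consisting of the vectors supported on \<open>verts G\<close>.
\<close>

definition edge_space ::
    "('v::finite, 'e) pre_digraph \<Rightarrow> ('e \<Rightarrow> real^2^2) \<Rightarrow> ('v \<Rightarrow> real^2) \<Rightarrow> 'e \<Rightarrow> (real^2^'v) set" where
  "edge_space G \<psi> p e =
     (let i = tail G e; j = head G e in
      if i = j then
        {x. \<exists>t. x $ i = t *\<^sub>R ((mat 2 - \<psi> e - matrix_inv (\<psi> e)) *v p i) \<and>
                (\<forall>w. w \<noteq> i \<longrightarrow> x $ w = 0)}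
      else
        {x. \<exists>t. x $ i = t *\<^sub>R (p i - \<psi> e *v p j) \<and>
                x $ j = t *\<^sub>R (p j - matrix_inv (\<psi> e) *v p i) \<and>
                (\<forall>w. w \<noteq> i \<and> w \<noteq> j \<longrightarrow> x $ w = 0)})"

section \<open>Dilworth truncation\<close>

text \<open>
  If no \<open>e \<in> F\<close> has \<open>h {e} \<ge> 0\<close>, the only partition is the empty one and the value is \<open>0\<close>.
\<close>

definition dilworth_truncation :: "('e set \<Rightarrow> int) \<Rightarrow> 'e set \<Rightarrow> int" where
  "dilworth_truncation h F =
     Min {\<Sum>A\<in>P. h A | P. partition_on {e \<in> F. h {e} \<ge> 0} P}"

end

theory Submission
  imports Defs
begin

text \<open>
  Write \<open>D\<^sub>e x = x(i) - \<psi>\<^sub>e x(j)\<close> for an edge \<open>e\<close> from \<open>i\<close> to \<open>j\<close>. Then \<open>R\<^sub>e(p)\<close> is spanned by the row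
  \<open>r\<^sub>e(p) = D\<^sub>e\<^sup>T D\<^sub>e p\<close>, and \<open>h\<^sub>\<rho>(F) + 1\<close> is the codimension of the common kernel of the \<open>D\<^sub>e\<close>, \<open>e \<in> F\<close>.
  A motion \<open>m\<close>, orthogonal to all rows, satisfies \<open>D\<^sub>e m = l\<^sub>e J D\<^sub>e p\<close> with \<open>J\<close> the quarter turn,
  which commutes with all gains.

  If \<open>l\<^sub>e\<close> is constant on \<open>F\<close> for every motion \<open>m\<close> of \<open>F\<close>, the motions are spanned by \<open>J p\<close> and the
  common kernel, so the rows of \<open>F\<close> have rank \<open>h\<^sub>\<rho>(F)\<close>. Otherwise choose \<open>m\<close> with non-constant \<open>l\<^sub>e\<close>. As
  \<open>p\<close> is generic, the rank cannot grow when \<open>p\<close> is perturbed in any direction, and this forces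
  \<open>r\<^sub>e(p) \<mapsto> l\<^sub>e r\<^sub>e(p)\<close> to extend to a linear map of the row space. Its eigenspaces are independent,
  so the rank is additive over a proper splitting of \<open>F\<close>. Iterating the splitting gives a
  partition attaining \<open>\<Sum>h\<^sub>\<rho>(F\<^sub>i)\<close>. Every partition gives an upper bound because \<open>J p\<close> is a motion.
\<close>

section \<open>Linearly independent families\<close>

text \<open>Independence is indexed by edges rather than stated for sets of vectors: rows of
  different edges may coincide, and one index set must serve while the vectors move.\<close>

definition independent_family :: "'i set \<Rightarrow> ('i \<Rightarrow> 'a::real_vector) \<Rightarrow> bool" where
  "independent_family I f \<longleftrightarrow> (\<forall>c. (\<Sum>i\<in>I. c i *\<^sub>R f i) = 0 \<longrightarrow> (\<forall>i\<in>I. c i = 0))"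

lemma independent_familyD:
  "independent_family I f \<Longrightarrow> (\<Sum>i\<in>I. c i *\<^sub>R f i) = 0 \<Longrightarrow> i \<in> I \<Longrightarrow> c i = 0"
  by (auto simp: independent_family_def)

lemma independent_family_subset:
  assumes "finite I" "J \<subseteq> I" "independent_family I f"
  shows "independent_family J f"
  unfolding independent_family_def
proof (intro allI impI ballI)
  fix c i assume c: "(\<Sum>i\<in>J. c i *\<^sub>R f i) = 0" and i: "i \<in> J"
  have "(\<Sum>i\<in>I. (if i \<in> J then c i else 0) *\<^sub>R f i) = (\<Sum>i\<in>J. c i *\<^sub>R f i)"
    using assms by (intro sum.mono_neutral_cong_right) auto
  from independent_familyD[OF assms(3) this[unfolded c], of i] i assms(2) show "c i = 0"
    by (auto split: if_splits)
qed

lemma independent_family_iff: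
  assumes "finite I"
  shows "independent_family I f \<longleftrightarrow> inj_on f I \<and> independent (f ` I)"
proof
  assume ind: "independent_family I f"
  have inj: "inj_on f I"
  proof (rule inj_onI, rule ccontr)
    fix x y assume xy: "x \<in> I" "y \<in> I" "f x = f y" "x \<noteq> y"
    have "independent_family {x, y} f"
      using independent_family_subset[OF assms _ ind] xy by auto
    from independent_familyD[OF this, of "\<lambda>i. if i = x then 1 else -1" x] xy show False
      by auto
  qed
  have "independent (f ` I)"
    unfolding independent_explicit_finite_subsets
  proof (intro allI impI ballI)
    fix S u v assume S: "S \<subseteq> f ` I" and "finite S" and u: "(\<Sum>v\<in>S. u v *\<^sub>R v) = 0" and v: "v \<in> S"
    obtain J where J: "J \<subseteq> I" "S = f ` J" using S by (meson subset_image_iff)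
    have "(\<Sum>j\<in>J. u (f j) *\<^sub>R f j) = 0"
      using u J inj by (simp add: sum.reindex inj_on_subset)
    from independent_familyD[OF independent_family_subset[OF assms J(1) ind] this] v J(2)
    show "u v = 0" by auto
  qed
  with inj show "inj_on f I \<and> independent (f ` I)" by simp
next
  assume *: "inj_on f I \<and> independent (f ` I)"
  show "independent_family I f"
    unfolding independent_family_def
  proof (intro allI impI ballI)
    fix c i assume c: "(\<Sum>i\<in>I. c i *\<^sub>R f i) = 0" and i: "i \<in> I"
    let ?u = "\<lambda>v. c (the_inv_into I f v)"
    have "(\<Sum>v\<in>f ` I. ?u v *\<^sub>R v) = (\<Sum>i\<in>I. c i *\<^sub>R f i)"
      using * by (subst sum.reindex) (auto simp: the_inv_into_f_f intro!: sum.cong)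
    moreover have "\<nexists>u. (\<exists>v\<in>f ` I. u v \<noteq> 0) \<and> (\<Sum>v\<in>f ` I. u v *\<^sub>R v) = 0"
      using * assms by (subst dependent_finite[symmetric]) auto
    ultimately have "\<forall>v\<in>f ` I. ?u v = 0"
      unfolding c by meson
    then have "?u (f i) = 0"
      using i by simp
    then show "c i = 0" using * i by (simp add: the_inv_into_f_f)
  qed
qed

lemma card_independent_family_le_dim:
  fixes f :: "'i \<Rightarrow> 'a::euclidean_space"
  assumes "finite I" "independent_family I f" "f ` I \<subseteq> span S"
  shows "card I \<le> dim (span S)"
proof -
  from assms have "inj_on f I" "independent (f ` I)" by (auto simp: independent_family_iff)
  then have "card I = card (f ` I)" by (simp add: card_image)
  also have "\<dots> \<le> dim (span S)"
    using independent_card_le_dim[OF assms(3) \<open>independent (f ` I)\<close>] .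
  finally show ?thesis .
qed

lemma obtain_basis_family:
  fixes f :: "'i \<Rightarrow> 'a::euclidean_space"
  assumes "finite F"
  obtains B where "B \<subseteq> F" "independent_family B f" "span (f ` B) = span (f ` F)"
    "card B = dim (span (f ` F))"
proof -
  obtain C where C: "C \<subseteq> f ` F" "independent C" "f ` F \<subseteq> span C" "card C = dim (f ` F)"
    using basis_exists[of "f ` F"] by metis
  obtain B where B: "B \<subseteq> F" "inj_on f B" "C = f ` B"
    using C(1) by (meson subset_image_inj)
  have "independent_family B f"
    using B C assms by (simp add: independent_family_iff finite_subset)
  moreover have "span (f ` B) = span (f ` F)"
    using C B by (metis span_eq span_superset subset_trans)
  moreover have "card B = dim (span (f ` F))"
    using B C by (simp add: card_image)
  ultimately show thesis using that B by blast
qed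

lemma span_image_sum:
  assumes "finite B" "y \<in> span (f ` B)"
  obtains c where "y = (\<Sum>i\<in>B. c i *\<^sub>R f i)"
proof -
  have "\<exists>c. y = (\<Sum>i\<in>B. c i *\<^sub>R f i)"
    using assms(2)
  proof (induction rule: span_induct_alt)
    case base
    show ?case by (rule exI[of _ "\<lambda>_. 0"]) simp
  next
    case (step a x y)
    then obtain j c where "j \<in> B" "x = f j" "y = (\<Sum>i\<in>B. c i *\<^sub>R f i)" by auto
    then have "a *\<^sub>R x + y = (\<Sum>i\<in>B. (c i + (if i = j then a else 0)) *\<^sub>R f i)"
      using assms(1)
      by (simp add: scaleR_add_left sum.distrib if_distrib[of "\<lambda>z. z *\<^sub>R _"] cong: if_cong)
    then show ?case by (rule exI[where P = "\<lambda>c. _ = (\<Sum>i\<in>B. c i *\<^sub>R f i)"])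
  qed
  then show thesis using that by blast
qed

text \<open>Fraction-free Gaussian elimination: the only divisions are by functions in \<open>R\<close> not vanishing
  at \<open>x0\<close>.\<close>

lemma independent_family_eventually:
  fixes v :: "'i \<Rightarrow> 'x \<Rightarrow> 'a::euclidean_space" and R :: "('x \<Rightarrow> real) set"
  assumes diff: "\<And>f g. f \<in> R \<Longrightarrow> g \<in> R \<Longrightarrow> (\<lambda>x. f x - g x) \<in> R"
    and mult: "\<And>f g. f \<in> R \<Longrightarrow> g \<in> R \<Longrightarrow> (\<lambda>x. f x * g x) \<in> R"
    and nz: "\<And>f. f \<in> R \<Longrightarrow> f x0 \<noteq> 0 \<Longrightarrow> eventually (\<lambda>x. f x \<noteq> 0) \<Phi>"
    and fin: "finite I"
    and entries: "\<And>i b. i \<in> I \<Longrightarrow> b \<in> Basis \<Longrightarrow> (\<lambda>x. v i x \<bullet> b) \<in> R"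
    and ind: "independent_family I (\<lambda>i. v i x0)"
  shows "eventually (\<lambda>x. independent_family I (\<lambda>i. v i x)) \<Phi>"
  using fin entries ind
proof (induction I arbitrary: v rule: finite_induct)
  case empty
  show ?case by (simp add: independent_family_def)
next
  case (insert j I)
  have "v j x0 \<noteq> 0"
  proof
    assume "v j x0 = 0"
    then have "(\<Sum>i\<in>insert j I. (if i = j then 1 else 0) *\<^sub>R v i x0) = 0"
      using insert.hyps by (auto intro!: sum.neutral)
    from independent_familyD[OF insert.prems(2) this, of j] show False by simp
  qed
  then obtain b where b: "b \<in> Basis" "v j x0 \<bullet> b \<noteq> 0"
    using euclidean_all_zero_iff by blast
  define w where "w i x = (v j x \<bullet> b) *\<^sub>R v i x - (v i x \<bullet> b) *\<^sub>R v j x" for i x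
  have wsum: "(\<Sum>i\<in>I. c i *\<^sub>R w i x) =
      (v j x \<bullet> b) *\<^sub>R (\<Sum>i\<in>I. c i *\<^sub>R v i x) - (\<Sum>i\<in>I. c i * (v i x \<bullet> b)) *\<^sub>R v j x" for c x
    unfolding w_def
    by (simp add: scaleR_right.sum scaleR_left.sum scaleR_diff_right sum_subtractf algebra_simps)
  have "eventually (\<lambda>x. independent_family I (\<lambda>i. w i x)) \<Phi>"
  proof (rule insert.IH)
    fix i b' assume "i \<in> I" "b' \<in> (Basis :: 'a set)"
    then show "(\<lambda>x. w i x \<bullet> b') \<in> R"
      unfolding w_def inner_diff_left inner_scaleR_left
      using insert.prems(1) b(1) by (intro diff mult) auto
  next
    show "independent_family I (\<lambda>i. w i x0)"
      unfolding independent_family_def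
    proof (intro allI impI ballI)
      fix c i assume c: "(\<Sum>i\<in>I. c i *\<^sub>R w i x0) = 0" and i: "i \<in> I"
      \<comment> \<open>Undoing the elimination turns a dependency of the \<open>w i x0\<close> into
        one of the \<open>v i x0\<close>. The pivot \<open>v j x0 \<bullet> b\<close> is nonzero and
        can be cancelled from the coefficients.\<close>
      let ?d = "\<lambda>i. if i = j then - (\<Sum>i\<in>I. c i * (v i x0 \<bullet> b)) else (v j x0 \<bullet> b) * c i"
      have "(\<Sum>i\<in>I. ?d i *\<^sub>R v i x0) = (\<Sum>i\<in>I. ((v j x0 \<bullet> b) * c i) *\<^sub>R v i x0)"
        using insert.hyps by (intro sum.cong) auto
      then have "(\<Sum>i\<in>insert j I. ?d i *\<^sub>R v i x0) = 0"
        using c insert.hyps unfolding wsum by (simp add: scaleR_right.sum)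
      from independent_familyD[OF insert.prems(2) this, of i] i b insert.hyps show "c i = 0"
        by (auto split: if_splits)
    qed
  qed
  moreover have "eventually (\<lambda>x. v j x \<bullet> b \<noteq> 0) \<Phi>"
    by (rule nz) (use insert.prems(1) b in auto)
  ultimately show ?case
  proof eventually_elim
    case (elim x)
    show ?case
      unfolding independent_family_def
    proof (intro allI impI)
      fix d assume "(\<Sum>i\<in>insert j I. d i *\<^sub>R v i x) = 0"
      then have d: "d j *\<^sub>R v j x + (\<Sum>i\<in>I. d i *\<^sub>R v i x) = 0"
        using insert.hyps by simp
      then have d': "(\<Sum>i\<in>I. d i *\<^sub>R v i x) = - (d j *\<^sub>R v j x)"
        by (simp add: add_eq_0_iff)
      have "(\<Sum>i\<in>I. d i * (v i x \<bullet> b)) = (\<Sum>i\<in>I. d i *\<^sub>R v i x) \<bullet> b"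
        by (simp add: inner_sum_left)
      then have "(\<Sum>i\<in>I. d i *\<^sub>R w i x) = 0"
        unfolding wsum d' by simp
      then have 0: "\<forall>i\<in>I. d i = 0" using elim(1) by (auto simp: independent_family_def)
      then have "d j *\<^sub>R v j x = 0" using d by simp
      then have "d j = 0" using elim(2) by auto
      with 0 show "\<forall>i\<in>insert j I. d i = 0" by simp
    qed
  qed
qed

lemma dim_Un_le:
  fixes S T :: "'a::euclidean_space set"
  shows "dim (S \<union> T) \<le> dim S + dim T"
proof -
  have "dim (S \<union> T) = dim (span (S \<union> T))"
    by simp
  also have "\<dots> = dim {x + y | x y. x \<in> span S \<and> y \<in> span T}"
    by (simp only: span_Un)
  also have "\<dots> \<le> dim (span S) + dim (span T)"
    using dim_sums_Int[OF subspace_span subspace_span, of S T] by simp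
  finally show ?thesis by simp
qed

section \<open>Planar constraints\<close>

definition quarter_turn :: "real^2 \<Rightarrow> real^2" where
  "quarter_turn x = vector [- x $ 2, x $ 1]"

lemma quarter_turn_nth [simp]: "quarter_turn x $ 1 = - x $ 2" "quarter_turn x $ 2 = x $ 1"
  by (simp_all add: quarter_turn_def)

lemma linear_quarter_turn: "linear quarter_turn"
  by (rule linearI) (auto simp: vec_eq_iff forall_2)

lemma inner_real2: "(x::real^2) \<bullet> y = x $ 1 * y $ 1 + x $ 2 * y $ 2"
  by (simp add: inner_vec_def sum_2)

lemma inner_quarter_turn [simp]: "quarter_turn x \<bullet> quarter_turn y = x \<bullet> y"
  by (simp add: inner_real2)

lemma inner_quarter_turn_self [simp]: "x \<bullet> quarter_turn x = 0"
  by (simp add: inner_real2)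

text \<open>In the plane the orthogonal complement of a nonzero \<open>a\<close> is the line through
  \<open>quarter_turn a\<close>. The factor \<open>l\<close> becomes the angular velocity of an edge
  under a motion.\<close>

lemma orthogonal_imp_quarter_turn:
  fixes a b :: "real^2"
  assumes "a \<bullet> b = 0" "a \<noteq> 0"
  obtains l where "b = l *\<^sub>R quarter_turn a"
proof
  have "a \<bullet> a \<noteq> 0" using assms by simp
  then show "b = ((quarter_turn a \<bullet> b) / (a \<bullet> a)) *\<^sub>R quarter_turn a"
    using assms(1)
    by (simp add: vec_eq_iff forall_2 inner_real2 field_simps) (algebra)
qed

text \<open>The rank formula sees the graph only through these maps. In the application
  \<open>D e\<close> is the edge map and \<open>J\<close> turns every vertex vector by a right
  angle.\<close>

locale planar_constraints =
  fixes E :: "'e set" and D :: "'e \<Rightarrow> 'a::euclidean_space \<Rightarrow> real^2" and J :: "'a \<Rightarrow> 'a"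
  assumes finite_E: "finite E"
    and linear_D: "e \<in> E \<Longrightarrow> linear (D e)"
    and D_J: "e \<in> E \<Longrightarrow> D e (J x) = quarter_turn (D e x)"
begin

text \<open>For linear \<open>D e\<close> this is half the gradient of the squared length of
  \<open>D e x\<close>, hence a row of a rigidity matrix. It is linear in \<open>x\<close>, so rows
  move affinely along a line.\<close>

definition row :: "'e \<Rightarrow> 'a \<Rightarrow> 'a" where
  "row e x = adjoint (D e) (D e x)"

definition rank :: "'e set \<Rightarrow> 'a \<Rightarrow> nat" where
  "rank F x = dim (span ((\<lambda>e. row e x) ` F))"

definition common_kernel :: "'e set \<Rightarrow> 'a set" where
  "common_kernel F = {y. \<forall>e\<in>F. D e y = 0}"

text \<open>The rank of all \<open>D e\<close> stacked together, as opposed to the rank of the rows.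
  Integer valued because \<open>corank F - 1\<close>, which becomes \<open>h_rho\<close>, is
  \<open>-1\<close> when all the maps vanish.\<close>

definition corank :: "'e set \<Rightarrow> int" where
  "corank F = int DIM('a) - int (dim (common_kernel F))"

definition motions :: "'e set \<Rightarrow> 'a \<Rightarrow> 'a set" where
  "motions F x = {y. \<forall>e\<in>F. row e x \<bullet> y = 0}"

lemma row_inner: "e \<in> E \<Longrightarrow> row e x \<bullet> y = D e x \<bullet> D e y"
  unfolding row_def using adjoint_works[OF linear_D[of e], of y "D e x"] by (simp add: inner_commute)

lemma row_zero: "e \<in> E \<Longrightarrow> D e x = 0 \<Longrightarrow> row e x = 0"
  unfolding row_def by (simp add: linear_0 adjoint_linear linear_D)

lemma row_add_scaleR:
  "e \<in> E \<Longrightarrow> row e (x + t *\<^sub>R y) = row e x + t *\<^sub>R row e y"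
  unfolding row_def
  by (simp add: linear_add linear_scale linear_D adjoint_linear)

lemma dim_motions:
  "rank F x + dim (motions F x) = DIM('a)"
proof -
  let ?S = "span ((\<lambda>e. row e x) ` F)"
  have "motions F x = {y \<in> UNIV. \<forall>z\<in>?S. orthogonal z y}"
  proof (intro set_eqI iffI)
    fix y assume y: "y \<in> motions F x"
    have "orthogonal y z" if "z \<in> ?S" for z
      using that y
      by (intro orthogonal_to_span[of z]) (auto simp: motions_def orthogonal_def inner_commute)
    then show "y \<in> {y \<in> UNIV. \<forall>z\<in>?S. orthogonal z y}" by (simp add: orthogonal_commute)
  next
    fix y assume "y \<in> {y \<in> UNIV. \<forall>z\<in>?S. orthogonal z y}"
    then show "y \<in> motions F x" by (auto simp: motions_def orthogonal_def intro: span_base)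
  qed
  then show ?thesis
    using dim_subspace_orthogonal_to_vectors[of ?S UNIV] by (simp add: rank_def dim_UNIV)
qed

lemma subspace_common_kernel: "F \<subseteq> E \<Longrightarrow> subspace (common_kernel F)"
  using linear_D unfolding subspace_def common_kernel_def
  by (auto simp: linear_0 linear_add linear_scale subset_iff)

lemma J_notin_common_kernel:
  assumes "e \<in> F" "F \<subseteq> E" "D e x \<noteq> 0"
  shows "J x \<notin> common_kernel F"
proof
  assume "J x \<in> common_kernel F"
  then have "quarter_turn (D e x) = 0" using assms D_J[of e x] unfolding common_kernel_def by force
  then have "quarter_turn (D e x) \<bullet> quarter_turn (D e x) = 0" by simp
  with assms(3) show False by simp
qed

text \<open>The rotation \<open>J x\<close> about the origin is always an infinitesimal motion, hence the \<open>- 1\<close>.\<close>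

lemma rank_le_corank:
  assumes "F \<subseteq> E" "e \<in> F" "D e x \<noteq> 0"
  shows "int (rank F x) \<le> corank F - 1"
proof -
  have "insert (J x) (common_kernel F) \<subseteq> motions F x"
    using assms(1) by (auto simp: motions_def common_kernel_def row_inner D_J subset_iff)
  then have "dim (insert (J x) (common_kernel F)) \<le> dim (motions F x)" by (rule dim_subset)
  moreover have "span (common_kernel F) = common_kernel F"
    using subspace_common_kernel[OF assms(1)] by (simp only: span_eq_iff)
  then have "J x \<notin> span (common_kernel F)"
    using J_notin_common_kernel[OF assms(2,1,3)] by (simp only: not_False_eq_True)
  ultimately have "dim (common_kernel F) + 1 \<le> dim (motions F x)" by (simp add: dim_insert)
  then show ?thesis using dim_motions[of F x] by (simp add: corank_def)
qed

lemma corank_le_rank: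
  assumes "F \<subseteq> E" "motions F x \<subseteq> span (insert (J x) (common_kernel F))"
  shows "corank F - 1 \<le> int (rank F x)"
proof -
  have "dim (motions F x) \<le> dim (span (insert (J x) (common_kernel F)))"
    using assms(2) by (rule dim_subset)
  also have "\<dots> \<le> dim (common_kernel F) + 1" by (simp add: dim_insert)
  finally show ?thesis using dim_motions[of F x] by (simp add: corank_def)
qed

text \<open>Rank is subadditive over the blocks, and \<open>rank_le_corank\<close> applies to each
  of them since the blocks of a partition are nonempty.\<close>

lemma rank_le_partition:
  assumes F: "F \<subseteq> E" and nz: "\<forall>e\<in>F. D e x \<noteq> 0" and P: "partition_on F P"
  shows "int (rank F x) \<le> (\<Sum>A\<in>P. corank A - 1)"
proof -
  have sub: "rank (\<Union>Q) x \<le> (\<Sum>A\<in>Q. rank A x)" if "finite Q" for Q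
    using that
  proof (induction rule: finite_induct)
    case (insert A Q)
    have "rank (\<Union>(insert A Q)) x \<le> rank A x + rank (\<Union>Q) x"
      unfolding rank_def dim_span Union_insert image_Un by (rule dim_Un_le)
    with insert show ?case by simp
  qed (simp add: rank_def)
  have "finite P" using finite_elements[OF finite_subset[OF F finite_E] P] .
  from sub[OF this] have "int (rank F x) \<le> (\<Sum>A\<in>P. int (rank A x))"
    using partition_onD1[OF P] by (simp flip: of_nat_sum)
  also have "\<dots> \<le> (\<Sum>A\<in>P. corank A - 1)"
  proof (rule sum_mono)
    fix A assume A: "A \<in> P"
    then obtain e where "e \<in> A" using partition_onD3[OF P] by (metis ex_in_conv)
    moreover have "A \<subseteq> F" using A partition_onD1[OF P] by blast
    ultimately show "int (rank A x) \<le> corank A - 1"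
      using F nz by (intro rank_le_corank) auto
  qed
  finally show ?thesis .
qed

end

lemma partition_on_Un:
  assumes "partition_on A P" "partition_on B Q" "A \<inter> B = {}"
  shows "P \<inter> Q = {}" "partition_on (A \<union> B) (P \<union> Q)"
proof -
  have "X = {}" if "X \<in> P \<inter> Q" for X
    using that assms partition_onD1[OF assms(1)] partition_onD1[OF assms(2)] by blast
  then show "P \<inter> Q = {}" using partition_onD3[OF assms(1)] by blast
  show "partition_on (A \<union> B) (P \<union> Q)"
    using assms unfolding partition_on_def by (auto intro!: disjoint_union)
qed

section \<open>Points of maximal rank and the splitting by angular velocities\<close>

context planar_constraints
begin

text \<open>The form in which genericity of \<open>x\<close> is used: no subset of the rows has
  larger rank at another point.\<close>

definition max_rank :: "'a \<Rightarrow> bool" where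
  "max_rank x \<longleftrightarrow> (\<forall>F\<subseteq>E. \<forall>y. rank F y \<le> rank F x)"

text \<open>Along the line \<open>x + t y\<close> the dependency \<open>c\<close> of the rows at \<open>x\<close> yields the vector
  \<open>z = (\<Sum>e\<in>F. c e *\<^sub>R row e y)\<close> in the row space for every \<open>t \<noteq> 0\<close>. If \<open>z\<close> had a component along
  the motion \<open>m\<close>, it would increase the rank for small \<open>t\<close>.\<close>

lemma dependency_inner_motion:
  assumes max: "max_rank x" and F: "F \<subseteq> E"
    and m: "m \<in> motions F x" and c: "(\<Sum>e\<in>F. c e *\<^sub>R row e x) = 0"
  shows "(\<Sum>e\<in>F. c e * (row e y \<bullet> m)) = 0"
proof (rule ccontr)
  define z where "z = (\<Sum>e\<in>F. c e *\<^sub>R row e y)"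
  assume "(\<Sum>e\<in>F. c e * (row e y \<bullet> m)) \<noteq> 0"
  then have zm: "z \<bullet> m \<noteq> 0" by (simp add: z_def inner_sum_left)
  have finF: "finite F" using F finite_E by (rule finite_subset)
  obtain B where B: "B \<subseteq> F" "independent_family B (\<lambda>e. row e x)"
    "card B = dim (span ((\<lambda>e. row e x) ` F))"
    using obtain_basis_family[OF finF, of "\<lambda>e. row e x"] by metis
  have finB: "finite B" using B finF finite_subset by blast
  \<comment> \<open>\<open>Some e\<close> indexes the basis rows moved along the line and
    \<open>None\<close> the fixed vector \<open>z\<close>. At \<open>t = 0\<close> the family is
    independent, because \<open>m\<close> is orthogonal to the rows but not to
    \<open>z\<close>.\<close>
  define v where "v i t = (case i of None \<Rightarrow> z | Some e \<Rightarrow> row e (x + t *\<^sub>R y))"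
    for i and t :: real
  let ?I = "insert None (Some ` B)"
  have v0: "independent_family ?I (\<lambda>i. v i 0)"
    unfolding independent_family_def
  proof (intro allI impI)
    fix d :: "'e option \<Rightarrow> real"
    assume "(\<Sum>i\<in>?I. d i *\<^sub>R v i 0) = 0"
    then have d: "d None *\<^sub>R z + (\<Sum>e\<in>B. d (Some e) *\<^sub>R row e x) = 0"
      using finB by (simp add: v_def sum.reindex)
    have "(\<Sum>e\<in>B. d (Some e) *\<^sub>R row e x) \<bullet> m = 0"
      using m B(1) unfolding motions_def inner_sum_left by (intro sum.neutral) auto
    then have "d None * (z \<bullet> m) = (d None *\<^sub>R z + (\<Sum>e\<in>B. d (Some e) *\<^sub>R row e x)) \<bullet> m"
      by (simp add: inner_add_left)
    with d zm have 0: "d None = 0" by simp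
    with d have "(\<Sum>e\<in>B. d (Some e) *\<^sub>R row e x) = 0" by simp
    from independent_familyD[OF B(2) this] 0 show "\<forall>i\<in>?I. d i = 0" by auto
  qed
  \<comment> \<open>Functions continuous at \<open>0\<close> form the class \<open>R\<close> for the
    elimination. The value \<open>t = 0\<close> is excluded, as \<open>z\<close> is recovered from
    the moved rows by dividing by \<open>t\<close>.\<close>
  have "eventually (\<lambda>t. independent_family ?I (\<lambda>i. v i t)) (at 0)"
  proof (rule independent_family_eventually[where R = "{f. isCont f 0}" and ?x0.0 = 0])
    fix f :: "real \<Rightarrow> real" assume "f \<in> {f. isCont f 0}" "f 0 \<noteq> 0"
    then show "eventually (\<lambda>t. f t \<noteq> 0) (at 0)"
      by (auto simp: isCont_def intro: tendsto_imp_eventually_ne)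
  next
    fix i b assume i: "i \<in> ?I" and "b \<in> (Basis :: 'a set)"
    show "(\<lambda>t. v i t \<bullet> b) \<in> {f. isCont f 0}"
    proof (cases i)
      case (Some e)
      then have "e \<in> E" using i B F by auto
      then show ?thesis using Some by (simp add: v_def row_add_scaleR)
    qed (simp add: v_def)
  next
    fix f g :: "real \<Rightarrow> real" assume "f \<in> {f. isCont f 0}" "g \<in> {f. isCont f 0}"
    then show "(\<lambda>t. f t - g t) \<in> {f. isCont f 0}" "(\<lambda>t. f t * g t) \<in> {f. isCont f 0}"
      by simp_all
  qed (use v0 finB in simp_all)
  then have "eventually (\<lambda>t. t \<noteq> 0 \<and> independent_family ?I (\<lambda>i. v i t)) (at 0)"
    by (rule eventually_conj[rotated]) (simp add: eventually_at_filter)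
  then obtain t where t: "t \<noteq> 0" "independent_family ?I (\<lambda>i. v i t)"
    using eventually_happens'[of "at (0::real)"] by auto
  let ?x = "x + t *\<^sub>R y"
  have "(\<Sum>e\<in>F. c e *\<^sub>R row e ?x) = (\<Sum>e\<in>F. c e *\<^sub>R row e x + t *\<^sub>R (c e *\<^sub>R row e y))"
    using F by (intro sum.cong) (auto simp: row_add_scaleR scaleR_add_right)
  also have "\<dots> = t *\<^sub>R z"
    by (simp add: sum.distrib c z_def scaleR_right.sum)
  finally have "z = (1 / t) *\<^sub>R (\<Sum>e\<in>F. c e *\<^sub>R row e ?x)" using t(1) by simp
  also have "\<dots> \<in> span ((\<lambda>e. row e ?x) ` F)"
    by (intro span_scale span_sum) (auto intro: span_base)
  finally have "z \<in> span ((\<lambda>e. row e ?x) ` F)" .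
  then have "(\<lambda>i. v i t) ` ?I \<subseteq> span ((\<lambda>e. row e ?x) ` F)"
    using B(1) by (auto simp: v_def intro!: span_base)
  with t(2) finB have "card ?I \<le> rank F ?x"
    unfolding rank_def by (intro card_independent_family_le_dim) auto
  also have "\<dots> \<le> rank F x" using max F by (simp add: max_rank_def)
  finally show False using B(3) finB by (simp add: rank_def card_image)
qed

text \<open>If \<open>m\<close> moves the edge \<open>e\<close> with angular velocity \<open>l e\<close>, then \<open>row e x \<mapsto> l e *\<^sub>R row e x\<close>
  extends to a linear map of the row space. Rows with different velocities are
  eigenvectors for different eigenvalues.\<close>

lemma dependency_scaled:
  assumes max: "max_rank x" and F: "F \<subseteq> E" and m: "m \<in> motions F x"
    and l: "\<And>e. e \<in> F \<Longrightarrow> D e m = l e *\<^sub>R quarter_turn (D e x)"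
    and c: "(\<Sum>e\<in>F. c e *\<^sub>R row e x) = 0"
  shows "(\<Sum>e\<in>F. (c e * l e) *\<^sub>R row e x) = 0"
proof -
  have "(\<Sum>e\<in>F. (c e * l e) *\<^sub>R row e x) \<bullet> y = 0" for y
  proof -
    \<comment> \<open>The perturbation is taken in direction \<open>J y\<close>: then
      \<open>D e (J y)\<close> is the quarter turn of \<open>D e y\<close>, \<open>D e m\<close> is
      \<open>l e\<close> times that of \<open>D e x\<close>, and quarter turns preserve inner
      products.\<close>
    have "(\<Sum>e\<in>F. (c e * l e) *\<^sub>R row e x) \<bullet> y = (\<Sum>e\<in>F. c e * (row e (J y) \<bullet> m))"
      unfolding inner_sum_left
    proof (rule sum.cong[OF refl])
      fix e assume e: "e \<in> F"
      then have "row e (J y) \<bullet> m = l e * (D e x \<bullet> D e y)"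
        using F l[OF e] by (subst row_inner) (auto simp: D_J inner_commute subset_iff)
      also have "D e x \<bullet> D e y = row e x \<bullet> y" using e F by (subst row_inner) auto
      finally show "(c e * l e) *\<^sub>R row e x \<bullet> y = c e * (row e (J y) \<bullet> m)" by simp
    qed
    also have "\<dots> = 0" by (rule dependency_inner_motion[OF max F m c])
    finally show ?thesis .
  qed
  from this[of "\<Sum>e\<in>F. (c e * l e) *\<^sub>R row e x"] show ?thesis
    by (simp only: inner_eq_zero_iff)
qed

text \<open>Rows with \<open>l e = a\<close> lie in one eigenspace of the map behind
  \<open>dependency_scaled\<close>, the others in the sum of the remaining eigenspaces, so the two
  spans meet only in \<open>0\<close>.\<close>

lemma rank_split:
  assumes max: "max_rank x" and F: "F \<subseteq> E" and m: "m \<in> motions F x"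
    and l: "\<And>e. e \<in> F \<Longrightarrow> D e m = l e *\<^sub>R quarter_turn (D e x)"
  shows "rank {e\<in>F. l e = a} x + rank {e\<in>F. l e \<noteq> a} x \<le> rank F x"
proof -
  let ?r = "\<lambda>e. row e x"
  let ?A = "{e\<in>F. l e = a}" and ?C = "{e\<in>F. l e \<noteq> a}"
  let ?SA = "span (?r ` ?A)" and ?SC = "span (?r ` ?C)"
  have finF: "finite F" using F finite_E by (rule finite_subset)
  have "y = 0" if yA: "y \<in> ?SA" and yC: "y \<in> ?SC" for y
  proof -
    have "finite ?C" using finF by simp
    then obtain B where B: "B \<subseteq> ?C" "independent_family B ?r" "span (?r ` B) = ?SC"
      and "card B = dim ?SC"
      by (rule obtain_basis_family)
    have fin: "finite ?A" "finite B" using B(1) finF by (auto intro: finite_subset)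
    obtain f where f: "y = (\<Sum>e\<in>?A. f e *\<^sub>R ?r e)" using span_image_sum[OF fin(1) yA] .
    obtain g where g: "y = (\<Sum>e\<in>B. g e *\<^sub>R ?r e)"
      using span_image_sum[OF fin(2) yC[folded B(3)]] .
    \<comment> \<open>The two expressions of the common vector \<open>y\<close> give a dependency of
      the rows of \<open>F\<close>. On the side of \<open>?C\<close> a basis \<open>B\<close> is
      used, so that vanishing combinations have vanishing coefficients.\<close>
    define c where "c e = (if e \<in> ?A then f e else if e \<in> B then - g e else 0)" for e
    have disj: "?A \<inter> B = {}" and sub: "?A \<union> B \<subseteq> F" using B(1) by auto
    have split: "(\<Sum>e\<in>F. (c e * h e) *\<^sub>R ?r e) =
        (\<Sum>e\<in>?A. (f e * h e) *\<^sub>R ?r e) - (\<Sum>e\<in>B. (g e * h e) *\<^sub>R ?r e)" for h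
    proof -
      have "(\<Sum>e\<in>F. (c e * h e) *\<^sub>R ?r e) = (\<Sum>e\<in>?A \<union> B. (c e * h e) *\<^sub>R ?r e)"
        using sub finF by (intro sum.mono_neutral_right) (auto simp: c_def)
      also have "\<dots> = (\<Sum>e\<in>?A. (c e * h e) *\<^sub>R ?r e) + (\<Sum>e\<in>B. (c e * h e) *\<^sub>R ?r e)"
        using fin disj by (rule sum.union_disjoint)
      also have "(\<Sum>e\<in>?A. (c e * h e) *\<^sub>R ?r e) = (\<Sum>e\<in>?A. (f e * h e) *\<^sub>R ?r e)"
        by (intro sum.cong) (auto simp: c_def)
      also have "(\<Sum>e\<in>B. (c e * h e) *\<^sub>R ?r e) = (\<Sum>e\<in>B. - ((g e * h e) *\<^sub>R ?r e))"
        using disj by (intro sum.cong) (auto simp: c_def)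
      finally show ?thesis by (simp add: sum_negf)
    qed
    have "(\<Sum>e\<in>F. c e *\<^sub>R ?r e) = 0" using split[of "\<lambda>_. 1"] f g by simp
    from dependency_scaled[OF max F m l this]
    have "(\<Sum>e\<in>?A. (f e * l e) *\<^sub>R ?r e) = (\<Sum>e\<in>B. (g e * l e) *\<^sub>R ?r e)"
      unfolding split by simp
    also have "(\<Sum>e\<in>?A. (f e * l e) *\<^sub>R ?r e) = a *\<^sub>R y"
      unfolding f scaleR_right.sum by (intro sum.cong) (auto simp: mult.commute)
    \<comment> \<open>The map is applied to both expressions of \<open>y\<close>, and
      \<open>a *\<^sub>R y\<close> is subtracted. The factors \<open>l e - a\<close> are nonzero on
      \<open>B\<close>.\<close>
    finally have "(\<Sum>e\<in>B. (g e * (l e - a)) *\<^sub>R ?r e) = 0"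
      unfolding g by (simp add: algebra_simps sum_subtractf scaleR_right.sum)
    from independent_familyD[OF B(2) this] have "\<forall>e\<in>B. g e = 0" using B(1) by auto
    then show "y = 0" using g by simp
  qed
  then have "?SA \<inter> ?SC = {0}" by (auto simp: span_zero)
  then have "dim ?SA + dim ?SC = dim {u + w | u w. u \<in> ?SA \<and> w \<in> ?SC}"
    using dim_sums_Int[OF subspace_span subspace_span, of "?r ` ?A" "?r ` ?C"] by simp
  also have "\<dots> \<le> dim (span (?r ` F))"
  proof (rule dim_subset, safe)
    fix u w assume "u \<in> ?SA" "w \<in> ?SC"
    moreover have "?SA \<subseteq> span (?r ` F)" "?SC \<subseteq> span (?r ` F)" by (auto intro!: span_mono)
    ultimately show "u + w \<in> span (?r ` F)" by (auto intro: span_add)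
  qed
  finally show ?thesis by (simp add: rank_def)
qed

text \<open>Strong induction on \<open>F\<close>. If every motion has constant angular velocity, the
  one-block partition works; otherwise \<open>F\<close> is cut along a level set of the velocity of
  some motion, and \<open>rank_split\<close> adds up the bounds for the two parts.\<close>

lemma exists_partition_le_rank:
  assumes max: "max_rank x" and F: "F \<subseteq> E" and nz: "\<forall>e\<in>F. D e x \<noteq> 0"
  shows "\<exists>P. partition_on F P \<and> (\<Sum>A\<in>P. corank A - 1) \<le> int (rank F x)"
proof -
  have "finite F" using F finite_E by (rule finite_subset)
  then show ?thesis
    using F nz
  proof (induction F rule: finite_psubset_induct)
    case (psubset F)
    define l where "l m e = (SOME s. D e m = s *\<^sub>R quarter_turn (D e x))" for m e
    have ex: "\<exists>s. D e m = s *\<^sub>R quarter_turn (D e x)" if "e \<in> F" "m \<in> motions F x" for e m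
    proof -
      have "D e x \<bullet> D e m = 0" using that psubset.prems(1) by (auto simp: motions_def row_inner subset_iff)
      moreover have "D e x \<noteq> 0" using that psubset.prems(2) by blast
      ultimately show ?thesis by (metis orthogonal_imp_quarter_turn)
    qed
    have l: "D e m = l m e *\<^sub>R quarter_turn (D e x)" if "e \<in> F" "m \<in> motions F x" for e m
      unfolding l_def using someI_ex[OF ex[OF that]] .
    show ?case
    proof (cases "F = {}")
      case True
      then have "partition_on F {}" by (simp add: partition_on_empty)
      then show ?thesis by (intro exI[of _ "{}"]) simp
    next
      case False
      show ?thesis
      proof (cases "\<forall>m\<in>motions F x. \<exists>a. \<forall>e\<in>F. l m e = a")
        case True
        have "motions F x \<subseteq> span (insert (J x) (common_kernel F))"
        proof
          fix m assume m: "m \<in> motions F x"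
          with True obtain a where a: "\<forall>e\<in>F. l m e = a" by blast
          have "m - a *\<^sub>R J x \<in> common_kernel F"
            using l[OF _ m] a psubset.prems(1)
            by (auto simp: common_kernel_def linear_diff linear_scale linear_D D_J subset_iff)
          then show "m \<in> span (insert (J x) (common_kernel F))"
            unfolding span_insert by (auto intro: span_base)
        qed
        with corank_le_rank[OF psubset.prems(1)] have "corank F - 1 \<le> int (rank F x)" .
        then show ?thesis
          using partition_on_space[OF False] by (intro exI[of _ "{F}"]) simp
      next
        case False
        then obtain m where m: "m \<in> motions F x" and n: "\<And>a. \<not> (\<forall>e\<in>F. l m e = a)" by blast
        from \<open>F \<noteq> {}\<close> obtain e0 where e0: "e0 \<in> F" by blast
        \<comment> \<open>Taking the level of an actual edge makes both parts proper:
          \<open>e0\<close> is missing from \<open>?C\<close>, and non-constancy keeps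
          \<open>?A\<close> from being all of \<open>F\<close>.\<close>
        define a where "a = l m e0"
        let ?A = "{e\<in>F. l m e = a}" and ?C = "{e\<in>F. l m e \<noteq> a}"
        have "?A \<subset> F" "?C \<subset> F" using n[of a] e0 by (auto simp: a_def)
        moreover from this have "?A \<subseteq> E" "?C \<subseteq> E" "\<forall>e\<in>?A. D e x \<noteq> 0" "\<forall>e\<in>?C. D e x \<noteq> 0"
          using psubset.prems by auto
        ultimately have "\<exists>P. partition_on ?A P \<and> (\<Sum>X\<in>P. corank X - 1) \<le> int (rank ?A x)"
          and "\<exists>Q. partition_on ?C Q \<and> (\<Sum>X\<in>Q. corank X - 1) \<le> int (rank ?C x)"
          using psubset.IH[of ?A] psubset.IH[of ?C] by blast+
        then obtain P Q where P: "partition_on ?A P" "(\<Sum>X\<in>P. corank X - 1) \<le> int (rank ?A x)"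
          and Q: "partition_on ?C Q" "(\<Sum>X\<in>Q. corank X - 1) \<le> int (rank ?C x)"
          by blast
        have "?A \<inter> ?C = {}" by blast
        from partition_on_Un[OF P(1) Q(1) this]
        have disj: "P \<inter> Q = {}" and part: "partition_on (?A \<union> ?C) (P \<union> Q)" by blast+
        moreover have "?A \<union> ?C = F" by blast
        moreover have "(\<Sum>X\<in>P \<union> Q. corank X - 1) \<le> int (rank F x)"
        proof -
          have "finite P" "finite Q"
            using finite_elements[OF _ P(1)] finite_elements[OF _ Q(1)] psubset.hyps by auto
          then have "(\<Sum>X\<in>P \<union> Q. corank X - 1) = (\<Sum>X\<in>P. corank X - 1) + (\<Sum>X\<in>Q. corank X - 1)"
            using disj by (rule sum.union_disjoint)
          also have "\<dots> \<le> int (rank ?A x) + int (rank ?C x)" using P(2) Q(2) by (rule add_mono)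
          also have "\<dots> \<le> int (rank F x)"
            using rank_split[OF max psubset.prems(1) m, where l = "l m" and a = a] l m by auto
          finally show ?thesis .
        qed
        ultimately show ?thesis using part by metis
      qed
    qed
  qed
qed

section \<open>From maximal rank to the minimum over partitions\<close>

lemma max_rank_nonzero:
  assumes max: "max_rank x" and e: "e \<in> E" and y: "D e y \<noteq> 0"
  shows "D e x \<noteq> 0"
proof
  assume "D e x = 0"
  then have "rank {e} x = 0" using row_zero[OF e] by (simp add: rank_def)
  moreover have "rank {e} y \<le> rank {e} x" using max e by (simp add: max_rank_def)
  ultimately have "row e y = 0" by (simp add: rank_def split: if_splits)
  then have "D e y \<bullet> D e y = 0" using row_inner[OF e, of y y] by simp
  with y show False by simp
qed

text \<open>A basis of the rows at \<open>y\<close> stays independent at \<open>x\<close> by the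
  same elimination as before, now with the principal filter of \<open>{x}\<close>. Hypothesis
  \<open>nz\<close> states that a function of \<open>R\<close> vanishing at \<open>x\<close>
  vanishes everywhere.\<close>

lemma max_rankI:
  fixes R :: "('a \<Rightarrow> real) set"
  assumes diff: "\<And>f g. f \<in> R \<Longrightarrow> g \<in> R \<Longrightarrow> (\<lambda>x. f x - g x) \<in> R"
    and mult: "\<And>f g. f \<in> R \<Longrightarrow> g \<in> R \<Longrightarrow> (\<lambda>x. f x * g x) \<in> R"
    and nz: "\<And>f y. f \<in> R \<Longrightarrow> f y \<noteq> 0 \<Longrightarrow> f x \<noteq> 0"
    and entries: "\<And>e b. e \<in> E \<Longrightarrow> b \<in> Basis \<Longrightarrow> (\<lambda>x. row e x \<bullet> b) \<in> R"
  shows "max_rank x"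
  unfolding max_rank_def
proof (intro allI impI)
  fix F y assume F: "F \<subseteq> E"
  have finF: "finite F" using F finite_E by (rule finite_subset)
  then obtain B where B: "B \<subseteq> F" "independent_family B (\<lambda>e. row e y)"
      and "span ((\<lambda>e. row e y) ` B) = span ((\<lambda>e. row e y) ` F)"
      and card: "card B = dim (span ((\<lambda>e. row e y) ` F))"
    by (rule obtain_basis_family)
  have finB: "finite B" using B(1) finF by (rule finite_subset)
  have "eventually (\<lambda>x. independent_family B (\<lambda>e. row e x)) (principal {x})"
    by (rule independent_family_eventually[where R = R and ?x0.0 = y])
      (use diff mult nz entries finB B F in \<open>auto simp: eventually_principal subset_iff\<close>)
  then have "independent_family B (\<lambda>e. row e x)" by (simp add: eventually_principal)
  then have "card B \<le> rank F x"
    unfolding rank_def using finB B(1)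
    by (intro card_independent_family_le_dim) (auto intro!: span_base)
  then show "rank F y \<le> rank F x" by (simp add: card rank_def)
qed

text \<open>The upper bound holds for every partition of \<open>F\<close> and is attained by one of
  them. Edges outside \<open>F\<close> have zero rows, so restricting to \<open>F\<close> preserves
  the rank; for a gain graph \<open>F\<close> is the set that the truncation partitions.\<close>

theorem rank_eq_Min_partition:
  assumes max: "max_rank x"
    and F: "F = {e\<in>E. \<exists>y. D e y \<noteq> 0}"
  shows "int (rank E x) = Min {\<Sum>A\<in>P. corank A - 1 | P. partition_on F P}"
proof -
  have FE: "F \<subseteq> E" and nzF: "\<forall>e\<in>F. D e x \<noteq> 0" using F max_rank_nonzero[OF max] by auto
  have finF: "finite F" using FE finite_E by (rule finite_subset)
  have "row e x = 0" if "e \<in> E - F" for e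
    using that F row_zero[of e x] by blast
  then have "row e x \<in> span ((\<lambda>e. row e x) ` F)" if "e \<in> E" for e
    using that by (cases "e \<in> F") (auto intro: span_base span_zero)
  then have "span ((\<lambda>e. row e x) ` E) \<subseteq> span ((\<lambda>e. row e x) ` F)"
    by (intro span_minimal subspace_span) auto
  then have "rank E x \<le> rank F x" unfolding rank_def by (rule dim_subset)
  moreover have "rank F x \<le> rank E x"
    unfolding rank_def by (intro dim_subset span_mono image_mono FE)
  ultimately have eq: "rank E x = rank F x" by simp
  let ?M = "{\<Sum>A\<in>P. corank A - 1 | P. partition_on F P}"
  have fin: "finite ?M"
    using finitely_many_partition_on[OF finF] by simp
  obtain P where P: "partition_on F P" "(\<Sum>A\<in>P. corank A - 1) \<le> int (rank F x)"
    using exists_partition_le_rank[OF max FE nzF] by blast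
  with rank_le_partition[OF FE nzF P(1)] have "int (rank F x) = (\<Sum>A\<in>P. corank A - 1)" by simp
  with P(1) have "int (rank F x) \<in> ?M" by auto
  moreover have "int (rank F x) \<le> n" if "n \<in> ?M" for n
    using that rank_le_partition[OF FE nzF] by auto
  ultimately show ?thesis unfolding eq by (intro Min_eqI[symmetric] fin) auto
qed

end

section \<open>Polynomial functions over a subfield\<close>

text \<open>This class serves as \<open>R\<close> in the elimination, where only values matter. A
  representing polynomial is recalled to apply algebraic independence.\<close>

definition polynomial_functions :: "'a::field set \<Rightarrow> 'i set \<Rightarrow> (('i \<Rightarrow> 'a) \<Rightarrow> 'a) set" where
  "polynomial_functions K I = {f. \<exists>P. (\<forall>m. Poly_Mapping.lookup P m \<in> K) \<and>
     (\<forall>m\<in>Poly_Mapping.keys P. Poly_Mapping.keys m \<subseteq> I) \<and> (\<forall>x. poly_value P x = f x)}"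

definition monomial_value :: "('i \<Rightarrow>\<^sub>0 nat) \<Rightarrow> ('i \<Rightarrow> 'a::comm_ring_1) \<Rightarrow> 'a" where
  "monomial_value m x = (\<Prod>i\<in>Poly_Mapping.keys m. x i ^ Poly_Mapping.lookup m i)"

lemma monomial_value_superset:
  assumes "finite S" "Poly_Mapping.keys m \<subseteq> S"
  shows "monomial_value m x = (\<Prod>i\<in>S. x i ^ Poly_Mapping.lookup m i)"
  unfolding monomial_value_def
  using assms by (intro prod.mono_neutral_left) (auto simp: in_keys_iff)

lemma monomial_value_add: "monomial_value (m + n) x = monomial_value m x * monomial_value n x"
proof -
  let ?S = "Poly_Mapping.keys m \<union> Poly_Mapping.keys n"
  have "monomial_value (m + n) x = (\<Prod>i\<in>?S. x i ^ Poly_Mapping.lookup (m + n) i)"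
    by (intro monomial_value_superset keys_add) auto
  also have "\<dots> = (\<Prod>i\<in>?S. x i ^ Poly_Mapping.lookup m i) * (\<Prod>i\<in>?S. x i ^ Poly_Mapping.lookup n i)"
    by (simp add: lookup_add power_add prod.distrib)
  also have "\<dots> = monomial_value m x * monomial_value n x"
    by (simp add: monomial_value_superset[of ?S])
  finally show ?thesis .
qed

lemma poly_value_superset:
  assumes "finite S" "Poly_Mapping.keys P \<subseteq> S"
  shows "poly_value P x = (\<Sum>m\<in>S. Poly_Mapping.lookup P m * monomial_value m x)"
  unfolding poly_value_def monomial_value_def
  using assms by (intro sum.mono_neutral_left) (auto simp: in_keys_iff)

lemma poly_value_add: "poly_value (P + Q) x = poly_value P x + poly_value Q x"
proof -
  let ?S = "Poly_Mapping.keys P \<union> Poly_Mapping.keys Q"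
  have "poly_value (P + Q) x = (\<Sum>m\<in>?S. Poly_Mapping.lookup (P + Q) m * monomial_value m x)"
    by (intro poly_value_superset keys_add) auto
  then show ?thesis
    by (simp add: poly_value_superset[of ?S] lookup_add distrib_right sum.distrib)
qed

lemma poly_value_single: "poly_value (Poly_Mapping.single m c) x = c * monomial_value m x"
proof -
  have "poly_value (Poly_Mapping.single m c) x =
      (\<Sum>n\<in>{m}. Poly_Mapping.lookup (Poly_Mapping.single m c) n * monomial_value n x)"
    by (rule poly_value_superset) auto
  then show ?thesis by simp
qed

lemma poly_value_eq:
  "poly_value P x = (\<Sum>m\<in>Poly_Mapping.keys P. Poly_Mapping.lookup P m * monomial_value m x)"
  by (simp add: poly_value_def monomial_value_def)

context
  fixes K :: "'a::field set" and I :: "'i set"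
  assumes K: "is_subfield K"
begin

lemma polynomial_functions_monomial:
  assumes "c \<in> K" "Poly_Mapping.keys m \<subseteq> I"
  shows "(\<lambda>x. c * monomial_value m x) \<in> polynomial_functions K I"
  unfolding polynomial_functions_def
proof (intro CollectI exI[of _ "Poly_Mapping.single m c"] conjI)
  show "\<forall>n. Poly_Mapping.lookup (Poly_Mapping.single m c) n \<in> K"
    using K assms by (auto simp: lookup_single when_def is_subfield_def)
qed (use assms in \<open>auto simp: poly_value_single split: if_splits\<close>)

lemma polynomial_functions_const: "c \<in> K \<Longrightarrow> (\<lambda>_. c) \<in> polynomial_functions K I"
  using polynomial_functions_monomial[of c 0] by (simp add: monomial_value_def)

lemma polynomial_functions_var: "i \<in> I \<Longrightarrow> (\<lambda>x. x i) \<in> polynomial_functions K I"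
  using polynomial_functions_monomial[of 1 "Poly_Mapping.single i 1"] K
  by (simp add: monomial_value_def is_subfield_def)

lemma polynomial_functions_add:
  assumes "f \<in> polynomial_functions K I" "g \<in> polynomial_functions K I"
  shows "(\<lambda>x. f x + g x) \<in> polynomial_functions K I"
proof -
  obtain P Q where P: "\<forall>m. Poly_Mapping.lookup P m \<in> K"
      "\<forall>m\<in>Poly_Mapping.keys P. Poly_Mapping.keys m \<subseteq> I" "\<forall>x. poly_value P x = f x"
    and Q: "\<forall>m. Poly_Mapping.lookup Q m \<in> K"
      "\<forall>m\<in>Poly_Mapping.keys Q. Poly_Mapping.keys m \<subseteq> I" "\<forall>x. poly_value Q x = g x"
    using assms unfolding polynomial_functions_def by blast
  show ?thesis
    unfolding polynomial_functions_def
  proof (intro CollectI exI[of _ "P + Q"] conjI)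
    show "\<forall>m. Poly_Mapping.lookup (P + Q) m \<in> K"
      using K P(1) Q(1) by (auto simp: lookup_add is_subfield_def)
    show "\<forall>m\<in>Poly_Mapping.keys (P + Q). Poly_Mapping.keys m \<subseteq> I"
      using P(2) Q(2) Poly_Mapping.keys_add[of P Q] by blast
    show "\<forall>x. poly_value (P + Q) x = f x + g x"
      using P(3) Q(3) by (simp add: poly_value_add)
  qed
qed

lemma polynomial_functions_sum:
  assumes "finite S" "\<And>s. s \<in> S \<Longrightarrow> f s \<in> polynomial_functions K I"
  shows "(\<lambda>x. \<Sum>s\<in>S. f s x) \<in> polynomial_functions K I"
  using assms
proof (induction rule: finite_induct)
  case empty
  show ?case using polynomial_functions_const[of 0] K by (simp add: is_subfield_def)
qed (simp add: polynomial_functions_add)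

lemma polynomial_functions_mult:
  assumes "f \<in> polynomial_functions K I" "g \<in> polynomial_functions K I"
  shows "(\<lambda>x. f x * g x) \<in> polynomial_functions K I"
proof -
  obtain P Q where P: "\<forall>m. Poly_Mapping.lookup P m \<in> K"
      "\<forall>m\<in>Poly_Mapping.keys P. Poly_Mapping.keys m \<subseteq> I" "\<forall>x. poly_value P x = f x"
    and Q: "\<forall>m. Poly_Mapping.lookup Q m \<in> K"
      "\<forall>m\<in>Poly_Mapping.keys Q. Poly_Mapping.keys m \<subseteq> I" "\<forall>x. poly_value Q x = g x"
    using assms unfolding polynomial_functions_def by blast
  have "(\<lambda>x. f x * g x) = (\<lambda>x. \<Sum>m\<in>Poly_Mapping.keys P. \<Sum>n\<in>Poly_Mapping.keys Q.
      (Poly_Mapping.lookup P m * Poly_Mapping.lookup Q n) * monomial_value (m + n) x)"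
  proof
    fix x
    have "f x * g x = poly_value P x * poly_value Q x" using P(3) Q(3) by simp
    also have "\<dots> = (\<Sum>m\<in>Poly_Mapping.keys P. \<Sum>n\<in>Poly_Mapping.keys Q.
        (Poly_Mapping.lookup P m * Poly_Mapping.lookup Q n) * monomial_value (m + n) x)"
      unfolding poly_value_eq sum_product
      by (intro sum.cong refl) (simp add: monomial_value_add mult_ac)
    finally show "f x * g x = \<dots>" .
  qed
  also have "\<dots> \<in> polynomial_functions K I"
  proof (intro polynomial_functions_sum polynomial_functions_monomial finite_keys)
    fix m n assume mn: "m \<in> Poly_Mapping.keys P" "n \<in> Poly_Mapping.keys Q"
    show "Poly_Mapping.lookup P m * Poly_Mapping.lookup Q n \<in> K"
      using K P(1) Q(1) by (simp add: is_subfield_def)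
    show "Poly_Mapping.keys (m + n) \<subseteq> I"
      using mn P(2) Q(2) Poly_Mapping.keys_add[of m n] by blast
  qed
  finally show ?thesis .
qed

lemma polynomial_functions_diff:
  assumes "f \<in> polynomial_functions K I" "g \<in> polynomial_functions K I"
  shows "(\<lambda>x. f x - g x) \<in> polynomial_functions K I"
proof -
  have "- 1 \<in> K" using K by (simp add: is_subfield_def)
  then have "(\<lambda>x. f x + (- 1) * g x) \<in> polynomial_functions K I"
    using assms by (intro polynomial_functions_add polynomial_functions_mult polynomial_functions_const)
  then show ?thesis by simp
qed

text \<open>If \<open>f x\<close> were zero, a representing polynomial would vanish at
  \<open>x\<close> and hence be \<open>0\<close>, which makes \<open>f\<close> zero
  everywhere.\<close>

lemma algebraically_independent_nonzero:
  assumes "algebraically_independent_over K I x" "f \<in> polynomial_functions K I" "f y \<noteq> 0"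
  shows "f x \<noteq> 0"
proof
  assume "f x = 0"
  obtain P where P: "\<forall>m. Poly_Mapping.lookup P m \<in> K"
      "\<forall>m\<in>Poly_Mapping.keys P. Poly_Mapping.keys m \<subseteq> I" "\<forall>x. poly_value P x = f x"
    using assms(2) unfolding polynomial_functions_def by blast
  then have v: "poly_value P x = 0" using \<open>f x = 0\<close> by simp
  from assms(1)[unfolded algebraically_independent_over_def, THEN spec, of P]
  have "P = 0" using P(1,2) v by (elim mp[OF mp[OF mp]])
  with P(3) assms(3) show False by (simp add: poly_value_def)
qed

end

lemma is_subfield_generated_subfield: "is_subfield (generated_subfield S)"
  unfolding is_subfield_def generated_subfield_def by blast

lemma generated_subfield_superset: "S \<subseteq> generated_subfield S"
  unfolding generated_subfield_def by blast

lemma coefficient_field_entry: "A \<in> \<Gamma> \<Longrightarrow> A $ r $ c \<in> coefficient_field \<Gamma>"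
  unfolding coefficient_field_def
  by (rule subsetD[OF generated_subfield_superset]) auto

section \<open>Rotations\<close>

lemma rotation2_mult_vec:
  "rotation2 t *v x = vector [cos t * x $ 1 - sin t * x $ 2, sin t * x $ 1 + cos t * x $ 2]"
  by (simp add: rotation2_def vec_eq_iff forall_2 matrix_vector_mult_def sum_2)

text \<open>Plane rotations commute with one another, the quarter turn included. This is the source
  of the locale assumption \<open>D_J\<close>.\<close>

lemma rotation_group_quarter_turn:
  "A \<in> rotation_group k \<Longrightarrow> A *v quarter_turn x = quarter_turn (A *v x)"
  by (auto simp: rotation_group_def rotation2_mult_vec) (simp add: vec_eq_iff forall_2)

lemma rotation_group_orthogonal: "A \<in> rotation_group k \<Longrightarrow> orthogonal_matrix A"
proof -
  have "orthogonal_matrix (rotation2 t)" for t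
    unfolding orthogonal_matrix
    by (auto simp: rotation2_def vec_eq_iff forall_2 matrix_matrix_mult_def sum_2 transpose_def mat_def
        power2_eq_square[symmetric] sin_cos_squared_add3)
  then show "A \<in> rotation_group k \<Longrightarrow> orthogonal_matrix A" by (auto simp: rotation_group_def)
qed

lemma orthogonal_matrix_inv:
  fixes A :: "real^'n^'n"
  assumes "orthogonal_matrix A"
  shows "matrix_inv A = transpose A"
proof -
  have A: "A ** transpose A = mat 1" "transpose A ** A = mat 1"
    using assms by (auto simp: orthogonal_matrix_def)
  then have "matrix_inv A ** A = mat 1"
    unfolding matrix_inv_def
    using someI_ex[of "\<lambda>B. A ** B = mat 1 \<and> B ** A = mat 1"] by blast
  then have "(matrix_inv A ** A) ** transpose A = transpose A" by simp
  then show ?thesis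
    using A(1) by (simp flip: matrix_mul_assoc)
qed

section \<open>The constraints of a gain graph\<close>

definition edge_map :: "('v::finite, 'e) pre_digraph \<Rightarrow> ('e \<Rightarrow> real^2^2) \<Rightarrow> 'e \<Rightarrow> real^2^'v \<Rightarrow> real^2"
  where "edge_map G \<psi> e x = x $ tail G e - \<psi> e *v (x $ head G e)"

definition quarter_turns :: "real^2^'v \<Rightarrow> real^2^'v" where
  "quarter_turns x = (\<chi> v. quarter_turn (x $ v))"

lemma linear_edge_map: "linear (edge_map G \<psi> e)"
  unfolding edge_map_def
  by (rule linearI) (simp_all add: matrix_vector_right_distrib matrix_vector_mult_scaleR algebra_simps)

lemma planar_constraints_edge_map:
  assumes "gain_graph (rotation_group k) G \<psi>"
  shows "planar_constraints (arcs G) (edge_map G \<psi>) quarter_turns"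
proof (rule planar_constraints.intro)
  fix e x assume "e \<in> arcs G"
  then have "\<psi> e \<in> rotation_group k" using assms by (auto simp: gain_graph_def)
  then show "edge_map G \<psi> e (quarter_turns x) = quarter_turn (edge_map G \<psi> e x)"
    by (simp add: edge_map_def quarter_turns_def rotation_group_quarter_turn linear_diff[OF linear_quarter_turn])
qed (use assms in \<open>simp_all add: gain_graph_def fin_digraph.finite_arcs linear_edge_map\<close>)

text \<open>Row entries are polynomials in the vertex coordinates over the field generated by the
  gain entries, so \<open>max_rankI\<close> applies with genericity as its nonvanishing
  hypothesis.\<close>

lemma max_rank_generic:
  fixes p :: "'v::finite \<Rightarrow> real^2"
  assumes gain: "gain_graph (rotation_group k) G \<psi>"
    and gen: "generic_on (rotation_group k) (verts G) p"
  shows "planar_constraints.max_rank (arcs G) (edge_map G \<psi>) (\<chi> v. p v)"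
proof -
  interpret planar_constraints "arcs G" "edge_map G \<psi>" quarter_turns
    by (rule planar_constraints_edge_map[OF gain])
  interpret G: fin_digraph G using gain by (simp add: gain_graph_def)
  let ?K = "coefficient_field (rotation_group k)"
  let ?I = "verts G \<times> (UNIV :: 2 set)"
  have K: "is_subfield ?K"
    unfolding coefficient_field_def by (rule is_subfield_generated_subfield)
  define conf :: "('v \<times> 2 \<Rightarrow> real) \<Rightarrow> real^2^'v" where "conf z = (\<chi> v c. z (v, c))" for z
  \<comment> \<open>Only coordinates of \<open>verts G\<close> may occur, because \<open>p\<close>
    is generic only there. The ends of every arc are such vertices.\<close>
  define R where "R = {f. (\<lambda>z. f (conf z)) \<in> polynomial_functions ?K ?I}"
  show ?thesis
  proof (rule max_rankI[where R = R])
    fix f y assume f: "f \<in> R" and y: "f y \<noteq> 0"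
    have "y = conf (\<lambda>(v, c). y $ v $ c)" "(\<chi> v. p v) = conf (\<lambda>(v, c). p v $ c)"
      by (simp_all add: conf_def vec_eq_iff)
    then show "f (\<chi> v. p v) \<noteq> 0"
      using algebraically_independent_nonzero[OF K gen[unfolded generic_on_def],
          of "\<lambda>z. f (conf z)" "\<lambda>(v, c). y $ v $ c"] f y
      by (simp add: R_def)
  next
    fix e and b :: "real^2^'v" assume e: "e \<in> arcs G" and b: "b \<in> Basis"
    have \<psi>: "\<psi> e $ r $ c \<in> ?K" for r c
      using gain e by (auto simp: gain_graph_def intro: coefficient_field_entry)
    note poly = polynomial_functions_add[OF K] polynomial_functions_diff[OF K]
      polynomial_functions_mult[OF K] polynomial_functions_const[OF K] polynomial_functions_var[OF K]
    have comp: "(\<lambda>z. edge_map G \<psi> e (conf z) $ r) \<in> polynomial_functions ?K ?I" for r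
      unfolding edge_map_def conf_def vector_minus_component matrix_vector_mult_def
      using e \<psi> by (simp add: sum_2 poly)
    have b': "b $ v $ c \<in> ?K" for v c
      using b K by (auto simp: Basis_vec_def axis_def is_subfield_def)
    have "edge_map G \<psi> e b $ r \<in> ?K" for r
      unfolding edge_map_def vector_minus_component matrix_vector_mult_def
      using \<psi> b' K unfolding is_subfield_def by (simp add: sum_2) (metis diff_conv_add_uminus)
    then show "(\<lambda>x. row e x \<bullet> b) \<in> R"
      using e comp by (simp add: R_def row_inner inner_real2 poly)
  qed (auto simp: R_def polynomial_functions_diff[OF K] polynomial_functions_mult[OF K])
qed

section \<open>Dimension of the common kernel\<close>

text \<open>Induction over the set \<open>A\<close> of coordinates that may be nonzero; a new
  coordinate \<open>w\<close> contributes a copy of \<open>S w\<close> as a direct summand.\<close>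

lemma dim_vec_subspaces:
  fixes S :: "'w::finite \<Rightarrow> 'a::euclidean_space set"
  assumes S: "\<And>w. subspace (S w)"
  shows "dim {m :: 'a^'w. \<forall>w. m $ w \<in> S w} = (\<Sum>w\<in>UNIV. dim (S w))"
proof -
  let ?T = "\<lambda>A. {m :: 'a^'w. (\<forall>w\<in>A. m $ w \<in> S w) \<and> (\<forall>w. w \<notin> A \<longrightarrow> m $ w = 0)}"
  have 0: "0 \<in> S w" for w using S by (rule subspace_0)
  have sub: "subspace (?T A)" for A
    using S unfolding subspace_def by auto
  have "finite A \<Longrightarrow> dim (?T A) = (\<Sum>w\<in>A. dim (S w))" for A
  proof (induction A rule: finite_induct)
    case empty
    have "?T {} = {0}" by (auto simp: vec_eq_iff)
    then show ?case by simp
  next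
    case (insert w A)
    let ?W = "axis w ` S w :: ('a^'w) set"
    have lin: "linear (axis w :: 'a \<Rightarrow> 'a^'w)"
      by (rule linearI) (auto simp: axis_def vec_eq_iff)
    have subW: "subspace ?W" using lin S by (rule linear_subspace_image)
    have "?T (insert w A) = {x + y | x y. x \<in> ?W \<and> y \<in> ?T A}"
    proof (intro set_eqI iffI)
      fix m assume m: "m \<in> ?T (insert w A)"
      have "m = axis w (m $ w) + (\<chi> v. if v = w then 0 else m $ v)"
        by (simp add: vec_eq_iff axis_def)
      moreover have "axis w (m $ w) \<in> ?W" using m by simp
      moreover have "(\<chi> v. if v = w then 0 else m $ v) \<in> ?T A" using m 0 by auto
      ultimately show "m \<in> {x + y | x y. x \<in> ?W \<and> y \<in> ?T A}" by blast
    next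
      fix m assume "m \<in> {x + y | x y. x \<in> ?W \<and> y \<in> ?T A}"
      then obtain s y where "m = axis w s + y" "s \<in> S w" "y \<in> ?T A" by blast
      then show "m \<in> ?T (insert w A)" using insert.hyps by (auto simp: axis_def)
    qed
    moreover have "?W \<inter> ?T A = {0}"
    proof -
      have "m = 0" if "m \<in> ?W" "m \<in> ?T A" for m
        using that insert.hyps by (auto simp: axis_def vec_eq_iff)
      moreover have "0 \<in> ?W \<inter> ?T A" using subspace_0[OF subW] subspace_0[OF sub] by blast
      ultimately show ?thesis by blast
    qed
    ultimately have "dim (?T (insert w A)) = dim ?W + dim (?T A)"
      using dim_sums_Int[OF subW sub[of A]] by simp
    also have "dim ?W = dim (S w)"
      using lin by (rule dim_image_eq) (auto simp: inj_on_def axis_eq_axis)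
    finally show ?case using insert by simp
  qed
  from this[of UNIV] show ?thesis by simp
qed

text \<open>An orthogonal matrix and its transpose fix the same vectors, so the common fixed space
  is the orthogonal complement of all images of \<open>mat 1 - A\<close>.\<close>

lemma dim_fixed_vectors:
  fixes \<Gamma> :: "(real^'n^'n) set"
  assumes orth: "\<And>A. A \<in> \<Gamma> \<Longrightarrow> orthogonal_matrix A"
  shows "dim {x. \<forall>A\<in>\<Gamma>. A *v x = x} + dim (span (\<Union>A\<in>\<Gamma>. range (\<lambda>x. (mat 1 - A) *v x))) = CARD('n)"
proof -
  let ?U = "\<Union>A\<in>\<Gamma>. range (\<lambda>x. (mat 1 - A) *v x)"
  have adj: "((mat 1 - A) *v x) \<bullet> y = x \<bullet> (y - transpose A *v y)" for A :: "real^'n^'n" and x y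
  proof -
    have "(A *v x) \<bullet> y = x \<bullet> (transpose A *v y)"
      using dot_lmul_matrix[of x "transpose A" y] by (simp flip: transpose_matrix_vector)
    then show ?thesis
      by (simp add: matrix_vector_mult_diff_rdistrib inner_diff_left inner_diff_right)
  qed
  have eq: "transpose A *v y = y \<longleftrightarrow> A *v y = y" if "A \<in> \<Gamma>" for A y
  proof -
    have "A ** transpose A = mat 1" "transpose A ** A = mat 1"
      using orth[OF that] by (auto simp: orthogonal_matrix_def)
    then show ?thesis
      by (metis matrix_vector_mul_assoc matrix_vector_mul_lid)
  qed
  have "{x. \<forall>A\<in>\<Gamma>. A *v x = x} = {y \<in> UNIV. \<forall>z\<in>span ?U. orthogonal z y}"
  proof (intro set_eqI iffI)
    fix y assume y: "y \<in> {x. \<forall>A\<in>\<Gamma>. A *v x = x}"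
    have "orthogonal y z" if "z \<in> span ?U" for z
      using that
    proof (rule orthogonal_to_span)
      fix u assume "u \<in> ?U"
      then obtain A x where A: "A \<in> \<Gamma>" "u = (mat 1 - A) *v x" by blast
      then have "transpose A *v y = y" using y eq by blast
      then show "orthogonal y u" using adj[of A x y] A(2) by (simp add: orthogonal_def inner_commute)
    qed
    then show "y \<in> {y \<in> UNIV. \<forall>z\<in>span ?U. orthogonal z y}" by (simp add: orthogonal_commute)
  next
    fix y assume y: "y \<in> {y \<in> UNIV. \<forall>z\<in>span ?U. orthogonal z y}"
    have "A *v y = y" if A: "A \<in> \<Gamma>" for A
    proof -
      have "x \<bullet> (y - transpose A *v y) = 0" for x
      proof -
        have "(mat 1 - A) *v x \<in> span ?U" using A by (intro span_base) blast
        with y have "orthogonal ((mat 1 - A) *v x) y" by blast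
        then show ?thesis unfolding orthogonal_def adj .
      qed
      from this[of "y - transpose A *v y"] have "transpose A *v y = y"
        by (simp only: inner_eq_zero_iff) simp
      with eq A show ?thesis by blast
    qed
    then show "y \<in> {x. \<forall>A\<in>\<Gamma>. A *v x = x}" by blast
  qed
  then show ?thesis
    using dim_subspace_orthogonal_to_vectors[of "span ?U" UNIV] by (simp only: subspace_span subspace_UNIV subset_UNIV dim_UNIV DIM_cart DIM_real mult_1_right)
qed

section \<open>Walks and the transport of values along them\<close>

fun gwalk :: "('v, 'e) pre_digraph \<Rightarrow> 'e set \<Rightarrow> 'v \<Rightarrow> ('e \<times> bool) list \<Rightarrow> 'v \<Rightarrow> bool" where
  "gwalk G X u [] v \<longleftrightarrow> u = v"
| "gwalk G X u ((e, b) # w) v \<longleftrightarrow> e \<in> X \<and> u = (if b then tail G e else head G e) \<and>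
     gwalk G X (if b then head G e else tail G e) w v"

text \<open>\<open>gwalk\<close> unfolds the walks of the bidirected graph edge by edge. The
  conjunct on \<open>u\<close> concerns the empty walk, which \<open>gwalk\<close> allows at any
  vertex.\<close>

lemma awalk_bidirected_iff:
  "pre_digraph.awalk (bidirected G X) u w v \<longleftrightarrow> u \<in> endverts G X \<and> gwalk G X u w v"
proof -
  have "set w \<subseteq> X \<times> UNIV \<and> pre_digraph.cas (bidirected G X) u w v \<longleftrightarrow> gwalk G X u w v"
    by (induction G X u w v rule: gwalk.induct)
      (auto simp: pre_digraph.cas.simps bidirected_def)
  then show ?thesis
    by (auto simp: pre_digraph.awalk_def bidirected_def)
qed

lemma gwalk_append: "gwalk G X u w v \<Longrightarrow> gwalk G X v w' z \<Longrightarrow> gwalk G X u (w @ w') z"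
  by (induction G X u w v rule: gwalk.induct) auto

lemma walk_gain_simps [simp]:
  "walk_gain \<psi> [] = mat 1"
  "walk_gain \<psi> (a # w) = step_gain \<psi> a ** walk_gain \<psi> w"
  by (simp_all add: walk_gain_def)

lemma walk_gain_append: "walk_gain \<psi> (w @ w') = walk_gain \<psi> w ** walk_gain \<psi> w'"
  by (induction w) (simp_all add: matrix_mul_assoc)

lemma walk_gain_orthogonal:
  assumes "\<And>e. e \<in> X \<Longrightarrow> orthogonal_matrix (\<psi> e)" "gwalk G X u w v"
  shows "orthogonal_matrix (walk_gain \<psi> w)"
  using assms(2)
proof (induction w arbitrary: u)
  case (Cons a w)
  then show ?case
    by (cases a)
      (auto simp: assms(1) orthogonal_matrix_inv intro!: orthogonal_matrix_mul split: if_splits)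
qed (simp add: orthogonal_matrix_id)

text \<open>A vanishing edge map says \<open>m $ tail G e = \<psi> e *v m $ head G e\<close>;
  backward, the inverse gain carries the value the other way. Induction along the walk composes
  these equations.\<close>

lemma walk_gain_transport:
  assumes orth: "\<And>e. e \<in> X \<Longrightarrow> orthogonal_matrix (\<psi> e)"
    and m: "\<And>e. e \<in> X \<Longrightarrow> edge_map G \<psi> e m = 0" and w: "gwalk G X u w v"
  shows "m $ u = walk_gain \<psi> w *v m $ v"
  using w
proof (induction w arbitrary: u)
  case (Cons a w)
  obtain e b where a: "a = (e, b)" by fastforce
  with Cons.prems have e: "e \<in> X" and u: "u = (if b then tail G e else head G e)"
    and w: "gwalk G X (if b then head G e else tail G e) w v" by auto
  have t: "m $ tail G e = \<psi> e *v m $ head G e" using m[OF e] by (simp add: edge_map_def)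
  have "transpose (\<psi> e) ** \<psi> e = mat 1" using orth[OF e] by (simp add: orthogonal_matrix_def)
  then have "m $ head G e = matrix_inv (\<psi> e) *v m $ tail G e"
    unfolding t orthogonal_matrix_inv[OF orth[OF e]]
    by (simp only: matrix_vector_mul_assoc matrix_vector_mul_lid)
  with t have "m $ u = step_gain \<psi> a *v m $ (if b then head G e else tail G e)"
    by (simp add: a u)
  with Cons.IH[OF w] show ?case by (simp only: walk_gain_simps matrix_vector_mul_assoc)
qed simp

section \<open>Connected components and the dimension of the common kernel\<close>

lemma fin_digraph_bidirected: "finite F \<Longrightarrow> fin_digraph (bidirected G F)"
  by unfold_locales (auto simp: bidirected_def endverts_def)

context
  fixes G :: "('v::finite, 'e) pre_digraph" and \<psi> :: "'e \<Rightarrow> real^2^2" and F :: "'e set"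
  assumes fin: "finite F" and orth: "\<And>e. e \<in> F \<Longrightarrow> orthogonal_matrix (\<psi> e)"
begin

abbreviation (input) sccs where "sccs \<equiv> pre_digraph.sccs_verts (bidirected G F)"

interpretation H: fin_digraph "bidirected G F"
  by (rule fin_digraph_bidirected[OF fin])

text \<open>Both orientations of \<open>e\<close> are arcs, so its ends reach each other and lie in
  the same strong component.\<close>

lemma scc_tail_iff_head:
  assumes U: "U \<in> sccs" and e: "e \<in> F"
  shows "tail G e \<in> U \<longleftrightarrow> head G e \<in> U"
proof -
  have "gwalk G F (tail G e) [(e, True)] (head G e)" "gwalk G F (head G e) [(e, False)] (tail G e)"
    using e by auto
  moreover have "tail G e \<in> endverts G F" "head G e \<in> endverts G F"
    using e by (auto simp: endverts_def)
  ultimately have "H.awalk (tail G e) [(e, True)] (head G e)" "H.awalk (head G e) [(e, False)] (tail G e)"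
    by (simp_all only: awalk_bidirected_iff simp_thms)
  then have "tail G e \<rightarrow>\<^sup>*\<^bsub>bidirected G F\<^esub> head G e" "head G e \<rightarrow>\<^sup>*\<^bsub>bidirected G F\<^esub> tail G e"
    by (auto intro: H.reachable_awalkI)
  with U show ?thesis unfolding H.in_sccs_verts_conv_reachable by blast
qed

lemma scc_subset: "U \<in> sccs \<Longrightarrow> U \<subseteq> endverts G F"
  using H.sccs_verts_subsets[of U] by (simp add: bidirected_def)

lemma endverts_component:
  assumes U: "U \<in> sccs"
  shows "endverts G {e \<in> F. tail G e \<in> U} = U"
  using scc_subset[OF U] scc_tail_iff_head[OF U] unfolding endverts_def by fast

lemma gwalk_scc:
  assumes U: "U \<in> sccs" and uv: "u \<in> U" "v \<in> U"
  obtains w where "gwalk G {e \<in> F. tail G e \<in> U} u w v"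
proof -
  have "u \<rightarrow>\<^sup>*\<^bsub>bidirected G F\<^esub> v" using U uv unfolding H.in_sccs_verts_conv_reachable by blast
  then obtain w where "gwalk G F u w v"
    unfolding H.reachable_awalk awalk_bidirected_iff by blast
  then have "gwalk G {e \<in> F. tail G e \<in> U} u w v"
    using uv(1)
  proof (induction w arbitrary: u)
    case (Cons a w)
    then show ?case
      using scc_tail_iff_head[OF U, of "fst a"] by (cases a) (auto split: if_splits)
  qed simp
  then show thesis using that by blast
qed

lemma gain_subgroup_of_component:
  assumes U: "U \<in> sccs"
  shows "gain_subgroup_of G \<psi> {e \<in> F. tail G e \<in> U} =
    {walk_gain \<psi> w | w. gwalk G {e \<in> F. tail G e \<in> U} (SOME v. v \<in> U) w (SOME v. v \<in> U)}"
proof -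
  have "U \<noteq> {}" using U unfolding H.in_sccs_verts_conv_reachable by blast
  then have "(SOME v. v \<in> U) \<in> U" by (simp add: some_in_eq)
  then show ?thesis
    by (simp add: gain_subgroup_of_def gain_subgroup_def endverts_component[OF U] awalk_bidirected_iff)
qed

text \<open>A kernel vector is determined on a component by its value at a base vertex, and that
  value may be any vector fixed by the gains of closed walks there. Off \<open>endverts G F\<close>
  it is unconstrained, which cancels two dimensions per such vertex.\<close>

lemma dim_kernel_eq_sum:
  fixes Fix
  defines "Fix U \<equiv> {x. \<forall>A\<in>gain_subgroup_of G \<psi> {e \<in> F. tail G e \<in> U}. A *v x = x}"
  shows "int (2 * CARD('v)) - int (dim {m. \<forall>e\<in>F. edge_map G \<psi> e m = 0}) =
    2 * int (card (endverts G F)) - (\<Sum>U\<in>sccs. int (dim (Fix U)))"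
proof -
  let ?V = "endverts G F" and ?N = "{m. \<forall>e\<in>F. edge_map G \<psi> e m = 0}"
  let ?X = "\<lambda>U. {e \<in> F. tail G e \<in> U}"
  \<comment> \<open>The same base vertex as in \<open>gain_subgroup_of\<close>, because the edges of
    a component have exactly its vertices as ends.\<close>
  define base where "base U = (SOME v. v \<in> U)" for U :: "'v set"
  define Bs where "Bs = base ` sccs"
  define scc where "scc = H.scc_of"
  have disj: "U = U'" if "U \<in> sccs" "U' \<in> sccs" "w \<in> U" "w \<in> U'" for U U' w
    using H.sccs_verts_disjoint that by blast
  have base: "base U \<in> U" if "U \<in> sccs" for U
    using that unfolding H.in_sccs_verts_conv_reachable base_def by (simp add: some_in_eq)
  have scc: "scc w \<in> sccs" "w \<in> scc w" if "w \<in> ?V" for w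
    using that H.scc_of_in_sccs_verts[of w] H.in_scc_of_self[of w]
    by (auto simp: scc_def bidirected_def)
  have scc_eq: "scc w = U" if "U \<in> sccs" "w \<in> U" for w U
    using scc[of w] disj that scc_subset by blast
  have BsV: "Bs \<subseteq> ?V" using base scc_subset by (auto simp: Bs_def)
  have orthX: "orthogonal_matrix (walk_gain \<psi> w)" if "gwalk G (?X U) u w v" for U u w v
    using that by (rule walk_gain_orthogonal[rotated]) (use orth in auto)
  have Fix: "Fix U = {x. \<forall>w. gwalk G (?X U) (base U) w (base U) \<longrightarrow> walk_gain \<psi> w *v x = x}"
    if "U \<in> sccs" for U
    unfolding Fix_def gain_subgroup_of_component[OF that] base_def by blast
  have transport: "m $ u = walk_gain \<psi> w *v m $ v" if "m \<in> ?N" "gwalk G (?X U) u w v" for m U u w v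
    using that(2) by (rule walk_gain_transport[rotated 2]) (use orth that in auto)
  \<comment> \<open>The product of the \<open>S w\<close> is the image of the kernel under the
    projection \<open>r\<close> below: fixed spaces at base vertices, zero at the other ends of
    \<open>F\<close>, everything off \<open>?V\<close>.\<close>
  define S where "S w = (if w \<in> ?V then if w \<in> Bs then Fix (scc w) else {0} else UNIV)" for w
  have subFix: "subspace (Fix U)" for U
    unfolding subspace_def Fix_def by (simp add: matrix_vector_right_distrib matrix_vector_mult_scaleR)
  then have subS: "subspace (S w)" for w by (simp add: S_def subspace_UNIV)
  define r :: "real^2^'v \<Rightarrow> real^2^'v"
    where "r m = (\<chi> w. if w \<in> ?V \<and> w \<notin> Bs then 0 else m $ w)" for m
  have lin: "linear r" by (rule linearI) (auto simp: r_def vec_eq_iff)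
  have subN: "subspace ?N"
    unfolding subspace_def using linear_edge_map[of G \<psi>]
    by (simp add: linear_0 linear_add linear_scale)
  have walk_to_base: "\<exists>w. gwalk G (?X (scc u)) u w (base (scc u))" if "u \<in> ?V" for u
    using gwalk_scc[OF scc(1)[OF that] scc(2)[OF that] base[OF scc(1)[OF that]]] by blast
  then obtain W where W: "\<And>u. u \<in> ?V \<Longrightarrow> gwalk G (?X (scc u)) u (W u) (base (scc u))"
    by metis
  have base_Bs: "base (scc u) \<in> Bs" if "u \<in> ?V" for u using scc(1)[OF that] by (auto simp: Bs_def)
  have inj: "inj_on r ?N"
  proof (rule inj_onI)
    fix m m' assume m: "m \<in> ?N" and m': "m' \<in> ?N" and eq: "r m = r m'"
    have eq': "m $ u = m' $ u" if "u \<notin> ?V \<or> u \<in> Bs" for u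
      using arg_cong[OF eq, of "\<lambda>x. x $ u"] that by (auto simp: r_def)
    have "m $ u = m' $ u" for u
    proof (cases "u \<in> ?V")
      case True
      have "m $ u = walk_gain \<psi> (W u) *v m $ base (scc u)" using m W[OF True] by (rule transport)
      also have "\<dots> = walk_gain \<psi> (W u) *v m' $ base (scc u)"
        using eq'[of "base (scc u)"] base_Bs[OF True] by simp
      also have "\<dots> = m' $ u" using transport[OF m' W[OF True]] by simp
      finally show ?thesis .
    qed (simp add: eq')
    then show "m = m'" by (simp add: vec_eq_iff)
  qed
  have img: "r ` ?N = {m. \<forall>w. m $ w \<in> S w}"
  proof (intro set_eqI iffI)
    fix t assume "t \<in> r ` ?N"
    then obtain m where m: "m \<in> ?N" and t: "t = r m" by blast
    have "m $ u \<in> Fix (scc u)" if u: "u \<in> Bs" for u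
    proof -
      obtain U where U: "U \<in> sccs" "u = base U" using u unfolding Bs_def by blast
      then have "scc u = U" using base scc_eq by blast
      then show ?thesis using transport[OF m, of U u _ u] Fix[OF U(1)] U(2) by auto
    qed
    then show "t \<in> {m. \<forall>w. m $ w \<in> S w}" by (auto simp: t r_def S_def)
  next
    fix t assume t: "t \<in> {m. \<forall>w. m $ w \<in> S w}"
    have tFix: "t $ base (scc u) \<in> Fix (scc u)" if u: "u \<in> ?V" for u
    proof -
      have "t $ base (scc u) \<in> S (base (scc u))" using t by blast
      moreover have "base (scc u) \<in> ?V" using base_Bs[OF u] BsV by blast
      moreover have "scc (base (scc u)) = scc u" using scc_eq scc(1)[OF u] base by blast
      ultimately show ?thesis using base_Bs[OF u] by (simp add: S_def)
    qed
    \<comment> \<open>The candidate preimage of \<open>t\<close>: the value at each base vertex is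
      transported along the chosen walks \<open>W u\<close>.\<close>
    define m where "m = (\<chi> u. if u \<in> ?V then walk_gain \<psi> (W u) *v t $ base (scc u) else t $ u)"
    have "edge_map G \<psi> e m = 0" if e: "e \<in> F" for e
    proof -
      let ?i = "tail G e" and ?j = "head G e"
      have i: "?i \<in> ?V" and j: "?j \<in> ?V" using e by (auto simp: endverts_def)
      define U where "U = scc ?i"
      define x where "x = t $ base U"
      have U: "U \<in> sccs" "?i \<in> U" using scc[OF i] by (auto simp: U_def)
      then have jU: "?j \<in> U" using scc_tail_iff_head[OF U(1) e] by simp
      then have sj: "scc ?j = U" using scc_eq U(1) by blast
      \<comment> \<open>A walk \<open>w\<close> from the base closes up both \<open>W ?i\<close> and
        \<open>e\<close> followed by \<open>W ?j\<close>. Both closed gains fix \<open>x\<close>,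
        and cancelling the orthogonal gain of \<open>w\<close> yields the edge equation.\<close>
      obtain w where w: "gwalk G (?X U) (base U) w ?i" using gwalk_scc[OF U(1) base[OF U(1)] U(2)] .
      have "gwalk G (?X U) ?i ((e, True) # W ?j) (base U)" using e U(2) W[OF j] sj by simp
      then have "gwalk G (?X U) (base U) (w @ (e, True) # W ?j) (base U)" by (rule gwalk_append[OF w])
      moreover have "gwalk G (?X U) (base U) (w @ W ?i) (base U)"
        using gwalk_append[OF w] W[OF i] by (simp add: U_def)
      moreover have "x \<in> Fix U" using tFix[OF i] by (simp add: x_def U_def)
      ultimately have "walk_gain \<psi> (w @ (e, True) # W ?j) *v x = x" "walk_gain \<psi> (w @ W ?i) *v x = x"
        using Fix[OF U(1)] by auto
      then have "walk_gain \<psi> w *v (walk_gain \<psi> (W ?i) *v x) =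
          walk_gain \<psi> w *v (\<psi> e *v (walk_gain \<psi> (W ?j) *v x))"
        by (simp add: walk_gain_append matrix_vector_mul_assoc matrix_mul_assoc)
      moreover have "transpose (walk_gain \<psi> w) ** walk_gain \<psi> w = mat 1"
        using orthX[OF w] by (simp add: orthogonal_matrix_def)
      ultimately have "walk_gain \<psi> (W ?i) *v x = \<psi> e *v (walk_gain \<psi> (W ?j) *v x)"
        by (metis matrix_vector_mul_assoc matrix_vector_mul_lid)
      then show ?thesis using i j sj by (simp add: edge_map_def m_def x_def U_def)
    qed
    then have "m \<in> ?N" by blast
    moreover have "r m = t"
    proof -
      have "r m $ u = t $ u" for u
      proof -
        consider "u \<notin> ?V" | "u \<in> ?V" "u \<notin> Bs" | "u \<in> Bs" "u \<in> ?V" using BsV by blast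
        then show ?thesis
        proof cases
          case 1
          then show ?thesis using BsV by (auto simp: r_def m_def)
        next
          case 2
          then have "S u = {0}" by (simp add: S_def)
          with t have "t $ u = 0" by blast
          then show ?thesis using 2 by (simp add: r_def)
        next
          case 3
          then obtain U where U: "U \<in> sccs" "u = base U" unfolding Bs_def by blast
          then have sU: "scc u = U" using base scc_eq by blast
          \<comment> \<open>At a base vertex \<open>W u\<close> is itself a closed walk, possibly
            nonempty, so its gain fixes \<open>t $ u\<close>.\<close>
          have "walk_gain \<psi> (W u) *v t $ u = t $ u"
            using tFix[OF 3(2)] W[OF 3(2)] unfolding sU Fix[OF U(1)] U(2)[symmetric] by blast
          then show ?thesis using 3 sU U(2) by (simp add: r_def m_def)
        qed
      qed
      then show ?thesis by (simp add: vec_eq_iff)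
    qed
    ultimately show "t \<in> r ` ?N" by blast
  qed
  have "span ?N = ?N" using subN by (simp only: span_eq_iff)
  then have "inj_on r (span ?N)" using inj by (simp only:)
  then have "dim ?N = dim (r ` ?N)" by (rule dim_image_eq[OF lin, symmetric])
  also have "\<dots> = (\<Sum>w\<in>UNIV. dim (S w))" unfolding img using subS by (rule dim_vec_subspaces)
  finally have N: "dim ?N = (\<Sum>w\<in>UNIV. dim (S w))" .
  have "(\<Sum>w\<in>UNIV. int (dim (S w))) = (\<Sum>w\<in>?V. int (dim (S w))) + (\<Sum>w\<in>UNIV - ?V. int (dim (S w)))"
    by (subst sum.subset_diff[of ?V UNIV]) auto
  also have "(\<Sum>w\<in>UNIV - ?V. int (dim (S w))) = 2 * int (card (UNIV - ?V))"
    by (simp add: S_def)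
  also have "int (card (UNIV - ?V)) = int CARD('v) - int (card ?V)"
    by (simp add: card_Diff_subset card_mono of_nat_diff)
  also have "(\<Sum>w\<in>?V. int (dim (S w))) = (\<Sum>w\<in>Bs. int (dim (Fix (scc w))))"
    using BsV by (intro sum.mono_neutral_cong_right) (auto simp: S_def)
  also have "\<dots> = (\<Sum>U\<in>sccs. int (dim (Fix U)))"
  proof -
    have sb: "scc (base U) = U" if "U \<in> sccs" for U using that base scc_eq by blast
    have "inj_on base sccs" by (rule inj_on_inverseI) (rule sb)
    then show ?thesis unfolding Bs_def by (simp add: sum.reindex sb)
  qed
  finally show ?thesis unfolding N by simp
qed

text \<open>By \<open>dim_fixed_vectors\<close> each fixed space has dimension \<open>2\<close>
  minus that of the span in \<open>h_rho\<close>. The constants sum to twice the number of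
  components, and the \<open>+ 1\<close> undoes the \<open>- 1\<close> in
  \<open>h_rho\<close>.\<close>

lemma corank_eq_h_rho:
  "int (2 * CARD('v)) - int (dim {m. \<forall>e\<in>F. edge_map G \<psi> e m = 0}) = h_rho G \<psi> F + 1"
proof -
  let ?X = "\<lambda>U. {e \<in> F. tail G e \<in> U}"
  let ?d = "\<lambda>X. int (dim (span (\<Union>A\<in>gain_subgroup_of G \<psi> X. range (\<lambda>x. (mat 1 - A) *v x))))"
  have inj: "inj_on ?X sccs"
    by (rule inj_on_inverseI[of _ "endverts G"]) (rule endverts_component)
  have "int (dim {x. \<forall>A\<in>gain_subgroup_of G \<psi> (?X U). A *v x = x}) = 2 - ?d (?X U)"
    if U: "U \<in> sccs" for U
  proof -
    have "orthogonal_matrix A" if "A \<in> gain_subgroup_of G \<psi> (?X U)" for A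
      using that orth unfolding gain_subgroup_of_component[OF U]
      by (auto intro!: walk_gain_orthogonal[where X = "?X U"])
    from dim_fixed_vectors[of "gain_subgroup_of G \<psi> (?X U)", OF this] show ?thesis by simp
  qed
  then have "(\<Sum>U\<in>sccs. int (dim {x. \<forall>A\<in>gain_subgroup_of G \<psi> (?X U). A *v x = x})) =
      (\<Sum>U\<in>sccs. 2 - ?d (?X U))"
    by (intro sum.cong refl)
  also have "\<dots> = 2 * int (card sccs) - (\<Sum>U\<in>sccs. ?d (?X U))"
    by (simp add: sum_subtractf)
  also have "card sccs = card (components G F)"
    unfolding components_def using inj by (simp add: card_image)
  also have "(\<Sum>U\<in>sccs. ?d (?X U)) = (\<Sum>X\<in>components G F. ?d X)"
    unfolding components_def using inj by (simp add: sum.reindex)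
  finally show ?thesis
    unfolding dim_kernel_eq_sum h_rho_def by linarith
qed

end

section \<open>Edge spaces\<close>

lemma edge_space_eq_range:
  assumes gain: "gain_graph (rotation_group k) G \<psi>" and e: "e \<in> arcs G"
  shows "edge_space G \<psi> p e =
    range (\<lambda>t. t *\<^sub>R planar_constraints.row (edge_map G \<psi>) e (\<chi> v. p v))"
proof -
  interpret planar_constraints "arcs G" "edge_map G \<psi>" quarter_turns
    by (rule planar_constraints_edge_map[OF gain])
  let ?i = "tail G e" and ?j = "head G e"
  let ?P = "(\<chi> v. p v) :: real^2^'a"
  have orth: "orthogonal_matrix (\<psi> e)"
    using gain e by (auto simp: gain_graph_def intro: rotation_group_orthogonal)
  then have inv: "matrix_inv (\<psi> e) = transpose (\<psi> e)" and tt: "transpose (\<psi> e) ** \<psi> e = mat 1"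
    by (auto simp: orthogonal_matrix_inv orthogonal_matrix_def)
  define y where "y = edge_map G \<psi> e ?P"
  have y: "y = p ?i - \<psi> e *v p ?j" by (simp add: y_def edge_map_def)
  have ty: "transpose (\<psi> e) *v y = matrix_inv (\<psi> e) *v p ?i - p ?j"
    unfolding y inv matrix_vector_mult_diff_distrib matrix_vector_mul_assoc tt by simp
  have adj: "(transpose (\<psi> e) *v y) \<bullet> z = y \<bullet> (\<psi> e *v z)" for z
    using dot_lmul_matrix[of y "\<psi> e" z] by simp
  \<comment> \<open>The adjoint places \<open>y\<close> at the tail and
    \<open>- (transpose (\<psi> e) *v y)\<close> at the head; for a loop both fall on one coordinate
    and add up to the loop formula.\<close>
  have row: "row e ?P = axis ?i y - axis ?j (transpose (\<psi> e) *v y)"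
  proof (rule vector_eq_rdot[THEN iffD1], rule allI)
    fix z
    show "row e ?P \<bullet> z = (axis ?i y - axis ?j (transpose (\<psi> e) *v y)) \<bullet> z"
      unfolding row_inner[OF e] y_def[symmetric] inner_diff_left inner_axis' adj
      by (simp add: edge_map_def inner_diff_right)
  qed
  show ?thesis
  proof (cases "?i = ?j")
    case True
    have "row e ?P = axis ?i ((mat 2 - \<psi> e - matrix_inv (\<psi> e)) *v p ?i)"
    proof -
      have two: "mat 2 *v p ?i = p ?i + p ?i"
        by (simp add: vec_eq_iff matrix_vector_mult_def mat_def if_distrib[of "\<lambda>x. x * _"] cong: if_cong)
      have "row e ?P = axis ?i (y - transpose (\<psi> e) *v y)"
        unfolding row using True by (simp add: vec_eq_iff axis_def)
      also have "y - transpose (\<psi> e) *v y = (mat 2 - \<psi> e - matrix_inv (\<psi> e)) *v p ?i"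
        unfolding ty matrix_vector_mult_diff_rdistrib two unfolding y using True by simp
      finally show ?thesis .
    qed
    then have nth: "row e ?P $ w =
        (if w = ?i then (mat 2 - \<psi> e - matrix_inv (\<psi> e)) *v p ?i else 0)" for w
      by (simp add: axis_def)
    have "x \<in> edge_space G \<psi> p e \<longleftrightarrow> (\<exists>t. x = t *\<^sub>R row e ?P)" for x
    proof -
      have "x = t *\<^sub>R row e ?P \<longleftrightarrow>
          x $ ?i = t *\<^sub>R ((mat 2 - \<psi> e - matrix_inv (\<psi> e)) *v p ?i) \<and> (\<forall>w. w \<noteq> ?i \<longrightarrow> x $ w = 0)" for t
        unfolding vec_eq_iff[of x] vector_scaleR_component nth by auto
      then show ?thesis using True by (simp add: edge_space_def Let_def)
    qed
    then show ?thesis by auto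
  next
    case False
    have nth: "row e ?P $ w = (if w = ?i then p ?i - \<psi> e *v p ?j
        else if w = ?j then p ?j - matrix_inv (\<psi> e) *v p ?i else 0)" for w
      unfolding row ty unfolding y using False by (simp add: axis_def)
    have "x \<in> edge_space G \<psi> p e \<longleftrightarrow> (\<exists>t. x = t *\<^sub>R row e ?P)" for x
    proof -
      have "x = t *\<^sub>R row e ?P \<longleftrightarrow> x $ ?i = t *\<^sub>R (p ?i - \<psi> e *v p ?j) \<and>
          x $ ?j = t *\<^sub>R (p ?j - matrix_inv (\<psi> e) *v p ?i) \<and> (\<forall>w. w \<noteq> ?i \<and> w \<noteq> ?j \<longrightarrow> x $ w = 0)" for t
        unfolding vec_eq_iff[of x] vector_scaleR_component nth using False by auto
      then show ?thesis using False by (simp add: edge_space_def Let_def)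
    qed
    then show ?thesis by auto
  qed
qed

section \<open>The rank formula for generic gain graphs\<close>

theorem theorem6p7:
  fixes k :: nat
    and G :: "('v::finite, 'e) pre_digraph"
    and \<psi> :: "'e \<Rightarrow> real^2^2"
    and p :: "'v \<Rightarrow> real^2"
  assumes "k \<ge> 1"
    and "gain_graph (rotation_group k) G \<psi>"
    and "generic_on (rotation_group k) (verts G) p"
  shows "int (dim (span (\<Union>e\<in>arcs G. edge_space G \<psi> p e))) =
         dilworth_truncation (h_rho G \<psi>) (arcs G)"
proof -
  interpret planar_constraints "arcs G" "edge_map G \<psi>" quarter_turns
    by (rule planar_constraints_edge_map[OF assms(2)])
  let ?P = "(\<chi> v. p v) :: real^2^'v"
  let ?rows = "(\<lambda>e. row e ?P) ` arcs G"
  have max: "max_rank ?P" using assms(2,3) by (rule max_rank_generic)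
  have corank: "corank A - 1 = h_rho G \<psi> A" if A: "A \<subseteq> arcs G" for A
  proof -
    have "finite A" using A finite_E by (rule finite_subset)
    moreover have "orthogonal_matrix (\<psi> e)" if "e \<in> A" for e
      using that A assms(2) by (auto simp: gain_graph_def intro: rotation_group_orthogonal)
    ultimately show ?thesis
      using corank_eq_h_rho[of A \<psi> G] by (simp add: corank_def common_kernel_def)
  qed
  let ?F = "{e \<in> arcs G. h_rho G \<psi> {e} \<ge> 0}"
  \<comment> \<open>\<open>h_rho\<close> of one edge is \<open>corank {e} - 1\<close>, negative
    exactly when the edge map vanishes identically, that is, for loops with trivial gain. The
    truncation thus drops exactly the edges with zero rows.\<close>
  have F: "?F = {e \<in> arcs G. \<exists>y. edge_map G \<psi> e y \<noteq> 0}"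
  proof -
    have "h_rho G \<psi> {e} \<ge> 0 \<longleftrightarrow> (\<exists>y. edge_map G \<psi> e y \<noteq> 0)" if e: "e \<in> arcs G" for e
    proof -
      have "h_rho G \<psi> {e} \<ge> 0 \<longleftrightarrow> dim (common_kernel {e}) < DIM(real^2^'v)"
        using corank[of "{e}"] e unfolding corank_def by auto
      also have "\<dots> \<longleftrightarrow> common_kernel {e} \<noteq> UNIV"
      proof -
        have "span (common_kernel {e}) = common_kernel {e}"
          using subspace_common_kernel[of "{e}"] e by (simp only: span_eq_iff) simp
        then have "common_kernel {e} = UNIV \<longleftrightarrow> dim (common_kernel {e}) = DIM(real^2^'v)"
          by (metis dim_eq_full)
        then show ?thesis
          using dim_subset_UNIV[of "common_kernel {e}"] by linarith
      qed
      finally show ?thesis by (auto simp: common_kernel_def)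
    qed
    then show ?thesis by blast
  qed
  have "span (\<Union>e\<in>arcs G. edge_space G \<psi> p e) = span ?rows"
  proof (rule span_eq[THEN iffD2], intro conjI subsetI)
    fix x assume "x \<in> (\<Union>e\<in>arcs G. edge_space G \<psi> p e)"
    then obtain e t where "e \<in> arcs G" "x = t *\<^sub>R row e ?P"
      using edge_space_eq_range[OF assms(2)] by blast
    then show "x \<in> span ?rows" by (auto intro!: span_scale intro: span_base)
  next
    fix x assume "x \<in> ?rows"
    then obtain e where e: "e \<in> arcs G" "x = 1 *\<^sub>R row e ?P" by auto
    then have "x \<in> edge_space G \<psi> p e" using edge_space_eq_range[OF assms(2)] by blast
    then show "x \<in> span (\<Union>e\<in>arcs G. edge_space G \<psi> p e)" using e(1) by (auto intro: span_base)
  qed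
  then have "int (dim (span (\<Union>e\<in>arcs G. edge_space G \<psi> p e))) = int (rank (arcs G) ?P)"
    by (simp add: rank_def)
  also have "\<dots> = Min {\<Sum>A\<in>P. corank A - 1 | P. partition_on ?F P}"
    using max F by (rule rank_eq_Min_partition)
  also have "{\<Sum>A\<in>P. corank A - 1 | P. partition_on ?F P} =
      {\<Sum>A\<in>P. h_rho G \<psi> A | P. partition_on ?F P}"
  proof -
    have "(\<Sum>A\<in>P. corank A - 1) = (\<Sum>A\<in>P. h_rho G \<psi> A)" if "partition_on ?F P" for P
    proof (rule sum.cong[OF refl])
      fix A assume "A \<in> P"
      then have "A \<subseteq> arcs G" using partition_onD1[OF that] by blast
      then show "corank A - 1 = h_rho G \<psi> A" by (rule corank)
    qed
    then show ?thesis by (metis (no_types, lifting))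
  qed
  finally show ?thesis by (simp add: dilworth_truncation_def)
qed

end
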